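(* Let $G$ be a profinite group. Consider either of the following two cases: (1) $\mathcal{C}_\eta=\mathcal{O}_\eta$ for every function $\eta:\mathbb{N}\to\mathbb{N}$, and $\mathcal{J}$ is the class of just infinite profinite groups; or (2) $\mathcal{C}_\eta=\mathcal{O}^*_\eta$ for every $\eta:\mathbb{N}\to\mathbb{N}$, and $\mathcal{J}$ is the class of hereditarily just infinite profinite groups. In each case the following are equivalent: (i) $G$ is finite or $G\in\mathcal{J}$; (ii) there is some $\eta:\mathbb{N}\to\mathbb{N}$ for which $G$ is a $\mathcal{C}_\eta$-group; (iii) there is some $\eta:\mathbb{N}\to\mathbb{N}$ for which every image of $G$ is a $\mathcal{C}_\eta$-group; (iv) there is some $\eta:\mathbb{N}\to\mathbb{N}$, and some family of normal subgroups $\{N_i\mid i\in I\}$ of $G$, such that each $G/N_i$ is a $\mathcal{C}_\eta$-group and such that $G\cong\varprojlim G/N_i$. Moreover, (ii), (iii) and (iv) are equivalent for any specified $\eta$ (that is, for each fixed $\eta$, the assertions obtained from (ii), (iii), (iv) by using this particular $\eta$ are equivalent).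
   Context: All subgroups are closed, homomorphisms continuous; an image of $G$ means a quotient by a closed normal subgroup. $\mathbb{N}$ denotes the positive integers. A profinite group is just infinite if it is infinite and every non-trivial normal subgroup has finite index; it is hereditarily just infinite if every open subgroup of it (including itself) is just infinite. For a profinite group $G$ and a subgroup $H$, define $$\mathrm{Ob}_G(H)=H\cap\bigcap\{K\mid K \text{ open normal in } G,\ K\not\le H\},$$ $$\mathrm{Ob}^*_G(H)=H\cap\bigcap\{K\mid K \text{ open subgroup of } G,\ H\le N_G(K),\ K\not\le H\}.$$ Let $I^\lhd_n(G)$ be the intersection of all open normal subgroups of $G$ of index at most $n$. Put $\mathrm{OI}_n(G)=\mathrm{Ob}_G(I^\lhd_n(G))$ and $\mathrm{OI}^*_n(G)=\mathrm{Ob}^*_G(I^\lhd_n(G))$, and define functions $\mathbb{N}\to\mathbb{N}\cup\{\infty\}$ by $\mathrm{ob}_G(n)=|G:\mathrm{OI}_n(G)|$ and $\mathrm{ob}^*_G(n)=|G:\mathrm{OI}^*_n(G)|$. For $\eta:\mathbb{N}\to\mathbb{N}$, $\mathcal{O}_\eta$ is the class of profinite groups $G$ with $\mathrm{ob}_G(n)\le\eta(n)$ for every $n\in\mathbb{N}$, and $\mathcal{O}^*_\eta$ is the class of profinite groups $G$ with $\mathrm{ob}^*_G(n)\le\eta(n)$ for every $n\in\mathbb{N}$. In (iv), the inverse limit is over an inverse system: $I$ is directed, with $N_i\le N_j$ for $i\ge j$, and the maps are the natural quotient maps. *)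

theory Defs
  imports "HOL-Analysis.Analysis" "HOL-Algebra.Algebra"
begin

text \<open>
  A topological group is a pair of a group \<open>G\<close> (in the sense of HOL-Algebra) and an abstract
  topology \<open>T\<close> whose underlying set is \<open>carrier G\<close>. All subgroups are meant to be closed, so the
  predicates below that concern subgroups demand that they are closed or open.
\<close>

definition topological_group :: "('a, 'm) monoid_scheme \<Rightarrow> 'a topology \<Rightarrow> bool" where
  "topological_group G T \<longleftrightarrow>
     group G \<and> topspace T = carrier G \<and>
     continuous_map (prod_topology T T) T (\<lambda>(x, y). x \<otimes>\<^bsub>G\<^esub> y) \<and>
     continuous_map T T (\<lambda>x. inv\<^bsub>G\<^esub> x)"

definition totally_disconnected_space :: "'a topology \<Rightarrow> bool" where
  "totally_disconnected_space T \<longleftrightarrow>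
     (\<forall>x\<in>topspace T. connected_component_of_set T x = {x})"

definition profinite_group :: "('a, 'm) monoid_scheme \<Rightarrow> 'a topology \<Rightarrow> bool" where
  "profinite_group G T \<longleftrightarrow>
     topological_group G T \<and> compact_space T \<and> Hausdorff_space T \<and> totally_disconnected_space T"

definition topological_group_iso ::
    "('a, 'm) monoid_scheme \<Rightarrow> 'a topology \<Rightarrow> ('b, 'n) monoid_scheme \<Rightarrow> 'b topology \<Rightarrow> bool" where
  "topological_group_iso G T H S \<longleftrightarrow> (\<exists>\<phi>. \<phi> \<in> iso G H \<and> homeomorphic_map T S \<phi>)"

definition open_subgroup :: "'a set \<Rightarrow> ('a, 'm) monoid_scheme \<Rightarrow> 'a topology \<Rightarrow> bool" where
  "open_subgroup K G T \<longleftrightarrow> subgroup K G \<and> openin T K"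

definition open_normal :: "'a set \<Rightarrow> ('a, 'm) monoid_scheme \<Rightarrow> 'a topology \<Rightarrow> bool" where
  "open_normal K G T \<longleftrightarrow> K \<lhd> G \<and> openin T K"

definition closed_normal :: "'a set \<Rightarrow> ('a, 'm) monoid_scheme \<Rightarrow> 'a topology \<Rightarrow> bool" where
  "closed_normal N G T \<longleftrightarrow> N \<lhd> G \<and> closedin T N"

definition subgroup_index :: "('a, 'm) monoid_scheme \<Rightarrow> 'a set \<Rightarrow> enat" where
  "subgroup_index G H =
     (if finite (rcosets\<^bsub>G\<^esub> H) then enat (card (rcosets\<^bsub>G\<^esub> H)) else \<infinity>)"

definition just_infinite :: "('a, 'm) monoid_scheme \<Rightarrow> 'a topology \<Rightarrow> bool" where
  "just_infinite G T \<longleftrightarrow>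
     profinite_group G T \<and> infinite (carrier G) \<and>
     (\<forall>N. closed_normal N G T \<and> N \<noteq> {\<one>\<^bsub>G\<^esub>} \<longrightarrow> subgroup_index G N < \<infinity>)"

definition hereditarily_just_infinite :: "('a, 'm) monoid_scheme \<Rightarrow> 'a topology \<Rightarrow> bool" where
  "hereditarily_just_infinite G T \<longleftrightarrow>
     profinite_group G T \<and>
     (\<forall>H. open_subgroup H G T \<longrightarrow> just_infinite (G\<lparr>carrier := H\<rparr>) (subtopology T H))"

definition Ob :: "('a, 'm) monoid_scheme \<Rightarrow> 'a topology \<Rightarrow> 'a set \<Rightarrow> 'a set" where
  "Ob G T H = H \<inter> \<Inter>{K. open_normal K G T \<and> \<not> K \<subseteq> H}"

definition Ob_star :: "('a, 'm) monoid_scheme \<Rightarrow> 'a topology \<Rightarrow> 'a set \<Rightarrow> 'a set" where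
  "Ob_star G T H = H \<inter> \<Inter>{K. open_subgroup K G T \<and> H \<subseteq> normalizer G K \<and> \<not> K \<subseteq> H}"

definition I_normal :: "('a, 'm) monoid_scheme \<Rightarrow> 'a topology \<Rightarrow> nat \<Rightarrow> 'a set" where
  "I_normal G T n = carrier G \<inter> \<Inter>{K. open_normal K G T \<and> subgroup_index G K \<le> enat n}"

definition OI :: "('a, 'm) monoid_scheme \<Rightarrow> 'a topology \<Rightarrow> nat \<Rightarrow> 'a set" where
  "OI G T n = Ob G T (I_normal G T n)"

definition OI_star :: "('a, 'm) monoid_scheme \<Rightarrow> 'a topology \<Rightarrow> nat \<Rightarrow> 'a set" where
  "OI_star G T n = Ob_star G T (I_normal G T n)"

definition ob :: "('a, 'm) monoid_scheme \<Rightarrow> 'a topology \<Rightarrow> nat \<Rightarrow> enat" where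
  "ob G T n = subgroup_index G (OI G T n)"

definition ob_star :: "('a, 'm) monoid_scheme \<Rightarrow> 'a topology \<Rightarrow> nat \<Rightarrow> enat" where
  "ob_star G T n = subgroup_index G (OI_star G T n)"

text \<open>
  The functions from the positive integers to the positive integers are the elements of
  \<open>pos_funs\<close>; their value at \<open>0\<close> is irrelevant.
\<close>

definition pos_funs :: "(nat \<Rightarrow> nat) set" where
  "pos_funs = {1..} \<rightarrow> {1..}"

definition O_class :: "(nat \<Rightarrow> nat) \<Rightarrow> ('a, 'm) monoid_scheme \<Rightarrow> 'a topology \<Rightarrow> bool" where
  "O_class \<eta> G T \<longleftrightarrow> profinite_group G T \<and> (\<forall>n\<ge>1. ob G T n \<le> enat (\<eta> n))"

definition O_star_class :: "(nat \<Rightarrow> nat) \<Rightarrow> ('a, 'm) monoid_scheme \<Rightarrow> 'a topology \<Rightarrow> bool" where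
  "O_star_class \<eta> G T \<longleftrightarrow> profinite_group G T \<and> (\<forall>n\<ge>1. ob_star G T n \<le> enat (\<eta> n))"

definition quotient_topology :: "('a, 'm) monoid_scheme \<Rightarrow> 'a topology \<Rightarrow> 'a set \<Rightarrow> 'a set topology" where
  "quotient_topology G T N =
     topology (\<lambda>U. U \<subseteq> carrier (G Mod N) \<and> openin T {x \<in> topspace T. N #>\<^bsub>G\<^esub> x \<in> U})"

lemma openin_quotient_topology:
  "openin (quotient_topology G T N) U \<longleftrightarrow>
     U \<subseteq> carrier (G Mod N) \<and> openin T {x \<in> topspace T. N #>\<^bsub>G\<^esub> x \<in> U}"
proof -
  define pre where "pre U = {x \<in> topspace T. N #>\<^bsub>G\<^esub> x \<in> U}" for U
  define P where "P U \<longleftrightarrow> U \<subseteq> carrier (G Mod N) \<and> openin T (pre U)" for U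
  have "P (U \<inter> V)" if "P U" "P V" for U V
  proof -
    have "pre (U \<inter> V) = pre U \<inter> pre V"
      unfolding pre_def by blast
    then show ?thesis
      using that unfolding P_def by (simp add: le_infI1 openin_Int)
  qed
  moreover have "P (\<Union>\<U>)" if "\<forall>U\<in>\<U>. P U" for \<U>
  proof -
    have "pre (\<Union>\<U>) = \<Union>(pre ` \<U>)"
      unfolding pre_def by blast
    then show ?thesis
      using that unfolding P_def by (auto simp: Sup_le_iff intro!: openin_Union)
  qed
  ultimately have "istopology P"
    unfolding istopology_def by simp
  moreover have "quotient_topology G T N = topology P"
    unfolding quotient_topology_def P_def pre_def ..
  ultimately show ?thesis
    by (simp add: P_def pre_def)
qed

lemma topspace_quotient_topology:
  assumes "topspace T = carrier G"
  shows "topspace (quotient_topology G T N) = carrier (G Mod N)"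
proof -
  have "{x \<in> topspace T. N #>\<^bsub>G\<^esub> x \<in> carrier (G Mod N)} = topspace T"
    using assms by (auto simp: FactGroup_def RCOSETS_def)
  then have "openin (quotient_topology G T N) (carrier (G Mod N))"
    by (simp add: openin_quotient_topology)
  then have "carrier (G Mod N) \<subseteq> topspace (quotient_topology G T N)"
    by (rule openin_subset)
  moreover have "topspace (quotient_topology G T N) \<subseteq> carrier (G Mod N)"
    using openin_topspace[of "quotient_topology G T N"] unfolding openin_quotient_topology by (rule conjunct1)
  ultimately show ?thesis
    by (rule subset_antisym[rotated])
qed

lemma quotient_map_quotient_topology:
  assumes "topspace T = carrier G"
  shows "quotient_map T (quotient_topology G T N) (\<lambda>x. N #>\<^bsub>G\<^esub> x)"
  unfolding quotient_map_def topspace_quotient_topology[OF assms]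
  using assms by (auto simp: openin_quotient_topology FactGroup_def RCOSETS_def)

definition every_image ::
    "('a set monoid \<Rightarrow> 'a set topology \<Rightarrow> bool) \<Rightarrow> ('a, 'm) monoid_scheme \<Rightarrow> 'a topology \<Rightarrow> bool" where
  "every_image C G T \<longleftrightarrow>
     (\<forall>N. closed_normal N G T \<longrightarrow> C (G Mod N) (quotient_topology G T N))"

text \<open>A pair \<open>(i, j) \<in> r\<close> stands for \<open>i \<le> j\<close>.\<close>

definition directed_set :: "'i set \<Rightarrow> 'i rel \<Rightarrow> bool" where
  "directed_set I r \<longleftrightarrow>
     I \<noteq> {} \<and> preorder_on I r \<and> (\<forall>i\<in>I. \<forall>j\<in>I. \<exists>k\<in>I. (i, k) \<in> r \<and> (j, k) \<in> r)"

text \<open>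
  The inverse limit of groups \<open>A i\<close> with topologies \<open>S i\<close> along maps \<open>f i j\<close> from \<open>A i\<close> to \<open>A j\<close>
  for \<open>i \<ge> j\<close>, realised inside the product.
\<close>

definition invlim_carrier ::
    "'i set \<Rightarrow> 'i rel \<Rightarrow> ('i \<Rightarrow> ('b, 'n) monoid_scheme) \<Rightarrow> ('i \<Rightarrow> 'i \<Rightarrow> 'b \<Rightarrow> 'b) \<Rightarrow> ('i \<Rightarrow> 'b) set" where
  "invlim_carrier I r A f =
     {x \<in> carrier (product_group I A). \<forall>i\<in>I. \<forall>j\<in>I. (j, i) \<in> r \<longrightarrow> f i j (x i) = x j}"

definition invlim_group ::
    "'i set \<Rightarrow> 'i rel \<Rightarrow> ('i \<Rightarrow> ('b, 'n) monoid_scheme) \<Rightarrow> ('i \<Rightarrow> 'i \<Rightarrow> 'b \<Rightarrow> 'b) \<Rightarrow> ('i \<Rightarrow> 'b) monoid" where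
  "invlim_group I r A f = (product_group I A)\<lparr>carrier := invlim_carrier I r A f\<rparr>"

definition invlim_topology ::
    "'i set \<Rightarrow> 'i rel \<Rightarrow> ('i \<Rightarrow> ('b, 'n) monoid_scheme) \<Rightarrow> ('i \<Rightarrow> 'b topology) \<Rightarrow> ('i \<Rightarrow> 'i \<Rightarrow> 'b \<Rightarrow> 'b)
       \<Rightarrow> ('i \<Rightarrow> 'b) topology" where
  "invlim_topology I r A S f = subtopology (product_topology S I) (invlim_carrier I r A f)"

text \<open>
  For \<open>N \<le> M\<close> the natural map from \<open>G Mod N\<close> to \<open>G Mod M\<close> sends the coset \<open>X = N #> g\<close> to
  \<open>M #> g\<close>, which is the product set \<open>set_mult G M X\<close>.
\<close>

definition natural_quotient_map ::
    "('a, 'm) monoid_scheme \<Rightarrow> 'a set \<Rightarrow> 'a set \<Rightarrow> 'a set \<Rightarrow> 'a set" where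
  "natural_quotient_map G N M = restrict (set_mult G M) (carrier (G Mod N))"

lemma natural_quotient_map_coset:
  assumes "group G" "N \<lhd> G" "M \<lhd> G" "N \<subseteq> M" "g \<in> carrier G"
  shows "natural_quotient_map G N M (N #>\<^bsub>G\<^esub> g) = M #>\<^bsub>G\<^esub> g"
proof -
  interpret group G by fact
  have N: "subgroup N G" and M: "subgroup M G"
    using assms by (auto simp: normal_def)
  have "set_mult G M N = M"
    using set_mult_subgroup_idem[OF M, of N] subgroup_incl[OF N M \<open>N \<subseteq> M\<close>] by blast
  moreover have "set_mult G M (N #>\<^bsub>G\<^esub> g) = set_mult G M N #>\<^bsub>G\<^esub> g"
    using setmult_rcos_assoc[OF subgroup.subset[OF M] subgroup.subset[OF N] assms(5)] by simp
  moreover have "N #>\<^bsub>G\<^esub> g \<in> carrier (G Mod N)"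
    using assms(5) by (auto simp: FactGroup_def RCOSETS_def)
  ultimately show ?thesis
    by (simp only: natural_quotient_map_def restrict_apply' simp_thms)
qed

definition inverse_limit_of_images ::
    "('a set monoid \<Rightarrow> 'a set topology \<Rightarrow> bool) \<Rightarrow> ('a, 'm) monoid_scheme \<Rightarrow> 'a topology
       \<Rightarrow> 'i set \<Rightarrow> 'i rel \<Rightarrow> ('i \<Rightarrow> 'a set) \<Rightarrow> bool" where
  "inverse_limit_of_images C G T I r N \<longleftrightarrow>
     directed_set I r \<and>
     (\<forall>i\<in>I. closed_normal (N i) G T) \<and>
     (\<forall>i\<in>I. \<forall>j\<in>I. (j, i) \<in> r \<longrightarrow> N i \<subseteq> N j) \<and>
     (\<forall>i\<in>I. C (G Mod N i) (quotient_topology G T (N i))) \<and>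
     topological_group_iso G T
       (invlim_group I r (\<lambda>i. G Mod N i) (\<lambda>i j. natural_quotient_map G (N i) (N j)))
       (invlim_topology I r (\<lambda>i. G Mod N i) (\<lambda>i. quotient_topology G T (N i))
          (\<lambda>i j. natural_quotient_map G (N i) (N j)))"

end

theory Submission
  imports Defs
begin

text \<open>
  Both cases run in parallel: \<open>Ob\<close> quantifies over open subgroups normalised by all of \<open>G\<close>, and
  \<open>Ob*\<close> over those normalised by \<open>H\<close>.

  For a closed normal subgroup \<open>M\<close>, let \<open>OI_n(M)\<close> be the variant of the obliquity subgroup of \<open>G\<close>
  in which only subgroups that contain \<open>M\<close> are used. It is the preimage in \<open>G\<close> of the obliquity
  subgroup of \<open>G/M\<close>, and it grows with \<open>M\<close>. So bounds on the index pass from \<open>G\<close> to its images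
  (\<open>every_image_bounded_obliquity_iff\<close>). Conversely, let closed normal subgroups \<open>M_i\<close> be directed
  downwards with trivial intersection. By compactness every open subgroup contains some \<open>M_i\<close>,
  whence the intersection of the \<open>OI_n(M_i)\<close> lies in \<open>OI_n(1)\<close>
  (\<open>OI_above_directed_Inter\<close>). The \<open>OI_n(M_i)\<close> are directed downwards too, and if their indices
  are bounded by \<open>\<eta>(n)\<close> then one of largest index equals the intersection. This gives the bound for
  an inverse limit (\<open>bounded_obliquity_inverse_limit\<close>); a single group \<open>G/1\<close> gives the converse.

  If \<open>G\<close> is just infinite and \<open>H\<close> is an open subgroup, then only finitely many open normal
  subgroups of \<open>G\<close> are not contained in \<open>H\<close> (\<open>just_infinite_finite_not_subset\<close>). Hence \<open>Ob(H)\<close> is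
  open; applied to some \<open>H\<close> of index greater than \<open>n\<close>, the same fact shows that \<open>G\<close> has finitely
  many open normal subgroups of index at most \<open>n\<close>. In the hereditary case it is applied to the
  normalisers of the subgroups \<open>K\<close> in question, which are among the finitely many subgroups above
  \<open>H\<close>. Conversely, let \<open>N\<close> be a non-trivial closed normal subgroup of \<open>G\<close>, or of an open subgroup
  in the hereditary case. Then \<open>N\<close> is an intersection of open subgroups that occur in the definition
  of the obliquity subgroup for large \<open>n\<close>, so it contains that subgroup and has finite index if
  the latter does (\<open>finite_index_imp_just_infinite_flag\<close>).
\<close>

section \<open>Indices and normalisers\<close>

lemma subgroup_index_finite_iff: "subgroup_index G H < \<infinity> \<longleftrightarrow> finite (rcosets\<^bsub>G\<^esub> H)"
  by (simp add: subgroup_index_def)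

context group
begin

lemma set_mult_r_coset:
  assumes "subgroup A G" "subgroup B G" "A \<subseteq> B" "x \<in> carrier G"
  shows "B <#> (A #> x) = B #> x"
proof -
  have "B <#> A = B"
    using set_mult_subgroup_idem[OF assms(2) subgroup_incl[OF assms(1-3)]] .
  then show ?thesis
    using setmult_rcos_assoc[of B A x] assms subgroup.subset by force
qed

lemma rcosets_subset_eq_image:
  assumes "subgroup A G" "subgroup B G" "A \<subseteq> B"
  shows "rcosets B = (\<lambda>Z. B <#> Z) ` (rcosets A)"
proof -
  have "(\<lambda>Z. B <#> Z) ` (rcosets A) = (\<lambda>x. B <#> (A #> x)) ` carrier G"
    unfolding RCOSETS_def by blast
  also have "\<dots> = (\<lambda>x. B #> x) ` carrier G"
    using set_mult_r_coset[OF assms] by simp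
  finally show ?thesis
    unfolding RCOSETS_def by blast
qed

lemma subgroup_index_antimono:
  assumes "subgroup A G" "subgroup B G" "A \<subseteq> B"
  shows "subgroup_index G B \<le> subgroup_index G A"
  unfolding subgroup_index_def rcosets_subset_eq_image[OF assms]
  by (simp add: card_image_le)

lemma subgroup_eq_of_index_le:
  assumes "subgroup A G" "subgroup B G" "A \<subseteq> B"
    and fin: "finite (rcosets A)" and le: "subgroup_index G A \<le> subgroup_index G B"
  shows "A = B"
proof
  have "finite (rcosets B)"
    using fin unfolding rcosets_subset_eq_image[OF assms(1-3)] by simp
  then have "card (rcosets A) \<le> card ((\<lambda>Z. B <#> Z) ` (rcosets A))"
    using le fin unfolding subgroup_index_def rcosets_subset_eq_image[OF assms(1-3)] by simp
  then have inj: "inj_on (\<lambda>Z. B <#> Z) (rcosets A)"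
    using fin by (simp add: eq_card_imp_inj_on card_image_le le_antisym)
  show "B \<subseteq> A"
  proof
    fix b assume b: "b \<in> B"
    then have bG: "b \<in> carrier G"
      using subgroup.subset[OF assms(2)] by blast
    have "B <#> (A #> b) = B <#> (A #> \<one>)"
      using b bG assms(1-3) by (simp add: set_mult_r_coset del: coset_mult_one)
        (metis coset_join2 coset_mult_one subgroup.subset)
    then have "A #> b = A #> \<one>"
      using inj_onD[OF inj] bG assms(1) by (meson one_closed rcosetsI subgroup.subset)
    then show "b \<in> A"
      using bG assms(1) by (metis coset_mult_one rcos_self subgroup.subset)
  qed
qed (fact assms)

lemma rcosets_eqI:
  assumes "subgroup K G" "A \<in> rcosets K" "B \<in> rcosets K" "x \<in> A" "x \<in> B"
  shows "A = B"
proof (rule ccontr)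
  assume "A \<noteq> B"
  from pairwiseD[OF rcos_disjoint[OF assms(1)] assms(2,3) this] show False
    using assms(4,5) by (auto simp: disjnt_iff)
qed

lemma finite_subgroups_above:
  assumes U: "subgroup U G" and fin: "finite (rcosets U)"
  shows "finite {K. subgroup K G \<and> U \<subseteq> K}"
proof -
  have "K \<in> Union ` Pow (rcosets U)" if "subgroup K G" "U \<subseteq> K" for K
  proof -
    have "(\<Union>x\<in>K. U #> x) = K"
    proof
      show "(\<Union>x\<in>K. U #> x) \<subseteq> K"
        using that by (auto simp: r_coset_def subgroup.m_closed)
      show "K \<subseteq> (\<Union>x\<in>K. U #> x)"
        using rcos_self[OF subgroup.mem_carrier[OF that(1)] U] by blast
    qed
    moreover have "(\<lambda>x. U #> x) ` K \<subseteq> rcosets U"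
      using rcosetsI[OF subgroup.subset[OF U] subgroup.mem_carrier[OF that(1)]] by blast
    ultimately show ?thesis
      by (metis (lifting) Pow_iff image_eqI)
  qed
  then have "{K. subgroup K G \<and> U \<subseteq> K} \<subseteq> Union ` Pow (rcosets U)"
    by (intro subsetI) (simp only: mem_Collect_eq)
  moreover have "finite (Union ` Pow (rcosets U))"
    using fin by (simp only: finite_imageI finite_Pow_iff)
  ultimately show ?thesis
    by (rule finite_subset)
qed

lemma finite_rcosets_of_finite:
  assumes "finite (carrier G)" shows "finite (rcosets H)"
  using assms unfolding RCOSETS_def by simp

lemma finite_carrier_of_finite_rcosets_one:
  assumes "finite (rcosets {\<one>})" shows "finite (carrier G)"
proof -
  have "rcosets {\<one>} = (\<lambda>x. {x}) ` carrier G"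
    unfolding RCOSETS_def r_coset_def by auto
  then show ?thesis
    using assms by (simp add: finite_image_iff)
qed

lemma mem_normalizer_iff:
  assumes "K \<subseteq> carrier G"
  shows "s \<in> normalizer G K \<longleftrightarrow> s \<in> carrier G \<and> (\<lambda>k. s \<otimes> k \<otimes> inv s) ` K = K"
proof -
  have "s <# K #> inv s = (\<lambda>k. s \<otimes> k \<otimes> inv s) ` K"
    by (auto simp: l_coset_def r_coset_def)
  then show ?thesis
    using assms by (simp add: normalizer_def stabilizer_def)
qed

lemma subset_normalizer_iff:
  assumes S: "subgroup S G" and K: "K \<subseteq> carrier G"
  shows "S \<subseteq> normalizer G K \<longleftrightarrow> (\<forall>s\<in>S. \<forall>k\<in>K. s \<otimes> k \<otimes> inv s \<in> K)"
proof
  assume "S \<subseteq> normalizer G K"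
  then show "\<forall>s\<in>S. \<forall>k\<in>K. s \<otimes> k \<otimes> inv s \<in> K"
    by (auto simp: subset_iff mem_normalizer_iff[OF K])
next
  assume *: "\<forall>s\<in>S. \<forall>k\<in>K. s \<otimes> k \<otimes> inv s \<in> K"
  show "S \<subseteq> normalizer G K"
  proof
    fix s assume s: "s \<in> S"
    then have sG: "s \<in> carrier G"
      using subgroup.mem_carrier[OF S] by blast
    have "k \<in> (\<lambda>k. s \<otimes> k \<otimes> inv s) ` K" if k: "k \<in> K" for k
    proof (rule image_eqI)
      show "inv s \<otimes> k \<otimes> s \<in> K"
        using *[rule_format, of "inv s" k] s sG k S by (simp add: subgroup.m_inv_closed)
      show "k = s \<otimes> (inv s \<otimes> k \<otimes> s) \<otimes> inv s"
        using sG subsetD[OF K k] by (simp add: m_assoc) (simp add: m_assoc[symmetric])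
    qed
    then show "s \<in> normalizer G K"
      using * s sG by (auto simp: mem_normalizer_iff[OF K])
  qed
qed

lemma normal_iff_subset_normalizer:
  "K \<lhd> G \<longleftrightarrow> subgroup K G \<and> carrier G \<subseteq> normalizer G K"
  using subset_normalizer_iff[OF subgroup_self, of K] subgroup.subset[of K G]
  by (auto simp: normal_inv_iff)

lemma normal_in_subgroup_iff:
  assumes "subgroup J G" "subgroup K G" "K \<subseteq> J"
  shows "K \<lhd> (G\<lparr>carrier := J\<rparr>) \<longleftrightarrow> J \<subseteq> normalizer G K"
proof -
  interpret J: group "G\<lparr>carrier := J\<rparr>"
    by (rule subgroup_imp_group) fact
  have "subgroup K (G\<lparr>carrier := J\<rparr>)"
    using assms by (intro subgroup_incl)
  moreover have "inv\<^bsub>G\<lparr>carrier := J\<rparr>\<^esub> x = inv x" if "x \<in> J" for x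
    using that assms(1) by (rule m_inv_consistent[rotated])
  ultimately show ?thesis
    using subset_normalizer_iff[OF assms(1), of K] subgroup.subset[OF assms(2)]
    by (auto simp: J.normal_inv_iff)
qed

end

section \<open>Profinite groups\<close>

text \<open>A profinite group with its topology, for use as a context.\<close>

locale profinite = group G for G (structure) +
  fixes T
  assumes profinite: "profinite_group G T"
begin

lemma topspace_eq: "topspace T = carrier G"
  using profinite by (simp add: profinite_group_def topological_group_def)

lemma compact: "compact_space T" and Hausdorff: "Hausdorff_space T"
  and totally_disconnected: "totally_disconnected_space T"
  using profinite by (simp_all add: profinite_group_def)

lemma continuous_map_mult:
  assumes "continuous_map Z T f" "continuous_map Z T g"
  shows "continuous_map Z T (\<lambda>x. f x \<otimes> g x)"
proof -
  have "continuous_map Z (prod_topology T T) (\<lambda>x. (f x, g x))"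
    using assms by (simp add: continuous_map_pairwise o_def)
  moreover have "continuous_map (prod_topology T T) T (\<lambda>(x, y). x \<otimes> y)"
    using profinite by (simp add: profinite_group_def topological_group_def)
  ultimately have "continuous_map Z T ((\<lambda>(x, y). x \<otimes> y) \<circ> (\<lambda>x. (f x, g x)))"
    by (rule continuous_map_compose)
  then show ?thesis
    by (simp add: o_def)
qed

lemma continuous_map_m_inv:
  assumes "continuous_map Z T f"
  shows "continuous_map Z T (\<lambda>x. inv (f x))"
proof -
  have "continuous_map T T (\<lambda>x. inv x)"
    using profinite by (simp add: profinite_group_def topological_group_def)
  from continuous_map_compose[OF assms this] show ?thesis
    by (simp add: o_def)
qed

lemma continuous_map_const_carrier: "g \<in> carrier G \<Longrightarrow> continuous_map Z T (\<lambda>_. g)"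
  by (simp add: topspace_eq)

lemmas continuous_map_group = continuous_map_mult continuous_map_m_inv continuous_map_const_carrier

lemma r_coset_eq_vimage:
  assumes "U \<subseteq> carrier G" "g \<in> carrier G"
  shows "U #> g = {x \<in> topspace T. x \<otimes> inv g \<in> U}"
proof -
  have "x \<in> U #> g" if "x \<in> carrier G" "x \<otimes> inv g \<in> U" for x
    using that assms unfolding r_coset_def
    by (auto intro!: bexI[of _ "x \<otimes> inv g"] simp: m_assoc)
  then show ?thesis
    using assms by (auto simp: topspace_eq r_coset_def m_assoc subset_iff)
qed

lemma openin_r_coset:
  assumes "openin T U" "g \<in> carrier G" shows "openin T (U #> g)"
proof -
  have "continuous_map T T (\<lambda>x. x \<otimes> inv g)"
    using assms by (intro continuous_map_group) auto
  from openin_continuous_map_preimage[OF this assms(1)] show ?thesis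
    using r_coset_eq_vimage[of U g] assms openin_subset topspace_eq by metis
qed

lemma closedin_r_coset:
  assumes "closedin T U" "g \<in> carrier G" shows "closedin T (U #> g)"
proof -
  have "continuous_map T T (\<lambda>x. x \<otimes> inv g)"
    using assms by (intro continuous_map_group) auto
  from closedin_continuous_map_preimage[OF this assms(1)] show ?thesis
    using r_coset_eq_vimage[of U g] assms closedin_subset topspace_eq by metis
qed

lemma openin_supergroup:
  assumes K: "open_subgroup K G T" and J: "subgroup J G" and "K \<subseteq> J"
  shows "openin T J"
proof -
  have "(\<Union>x\<in>J. K #> x) = J"
  proof
    show "(\<Union>x\<in>J. K #> x) \<subseteq> J"
      using subgroup.m_closed[OF J] \<open>K \<subseteq> J\<close> by (auto simp: r_coset_def)
    show "J \<subseteq> (\<Union>x\<in>J. K #> x)"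
      using rcos_self[OF subgroup.mem_carrier[OF J], of _ K] K unfolding open_subgroup_def by blast
  qed
  moreover have "openin T (\<Union>x\<in>J. K #> x)"
    using K openin_r_coset subgroup.mem_carrier[OF J]
    by (intro openin_Union) (auto simp: open_subgroup_def)
  ultimately show ?thesis
    by simp
qed

lemma Diff_subgroup_eq_Union_rcosets:
  assumes "subgroup K G"
  shows "carrier G - K = \<Union>(rcosets K - {K})"
proof
  have K: "K \<in> rcosets K"
    using assms subgroup.subgroup_in_rcosets is_group by blast
  show "\<Union>(rcosets K - {K}) \<subseteq> carrier G - K"
    using rcosets_part_G[OF assms] rcosets_eqI[OF assms _ K] by blast
  show "carrier G - K \<subseteq> \<Union>(rcosets K - {K})"
    using rcosets_part_G[OF assms] by blast
qed

lemma closedin_open_subgroup: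
  assumes "open_subgroup K G T" shows "closedin T K"
proof -
  have "openin T (\<Union>(rcosets K - {K}))"
    using assms by (intro openin_Union) (auto simp: open_subgroup_def RCOSETS_def intro: openin_r_coset)
  then show ?thesis
    using assms Diff_subgroup_eq_Union_rcosets[of K] topspace_eq openin_subset[of T K]
    by (simp add: open_subgroup_def closedin_def)
qed

lemma finite_rcosets_open_subgroup:
  assumes "open_subgroup K G T" shows "finite (rcosets K)"
proof -
  have K: "subgroup K G"
    using assms by (simp add: open_subgroup_def)
  have "openin T Z" if "Z \<in> rcosets K" for Z
    using that assms by (auto simp: open_subgroup_def RCOSETS_def intro: openin_r_coset)
  moreover have "topspace T \<subseteq> \<Union>(rcosets K)"
    using rcosets_part_G[OF K] topspace_eq by simp
  ultimately obtain F where F: "finite F" "F \<subseteq> rcosets K" "topspace T \<subseteq> \<Union>F"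
    using compact unfolding compact_space_alt by meson
  have "Z \<in> F" if Z: "Z \<in> rcosets K" for Z
  proof -
    obtain x where x: "x \<in> Z" "x \<in> carrier G"
      using Z K subgroup.rcosets_non_empty[OF K Z] rcosets_part_G[OF K] by blast
    then obtain Y where "Y \<in> F" "x \<in> Y"
      using F topspace_eq by blast
    then show ?thesis
      using rcosets_eqI[OF K Z] F(2) x(1) by blast
  qed
  then show ?thesis
    by (intro rev_finite_subset[OF F(1)] subsetI)
qed

lemma openin_closed_subgroup_finite_index:
  assumes N: "subgroup N G" "closedin T N" and fin: "finite (rcosets N)"
  shows "openin T N"
proof -
  have "closedin T (\<Union>(rcosets N - {N}))"
    using assms by (intro closedin_Union) (auto simp: RCOSETS_def intro: closedin_r_coset)
  then have "closedin T (topspace T - N)"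
    using Diff_subgroup_eq_Union_rcosets[OF N(1)] topspace_eq by simp
  then show ?thesis
    using closedin_subset[OF N(2)] openin_closedin_eq by blast
qed

text \<open>The tube lemma.\<close>

lemma openin_Ball_compact:
  assumes C: "compactin T C" and f: "continuous_map (prod_topology T T) T (\<lambda>(x, y). f x y)"
    and W: "openin T W"
  shows "openin T {x \<in> carrier G. \<forall>y\<in>C. f x y \<in> W}"
proof -
  have CG: "C \<subseteq> topspace T"
    using C compactin_subset_topspace by blast
  have "continuous_map (prod_topology T (subtopology T C)) T (\<lambda>(x, y). f x y)"
    using continuous_map_from_subtopology[OF f, of "topspace T \<times> C"]
    by (simp add: prod_topology_subtopology(2))
  then have "closedin (prod_topology T (subtopology T C))
      {p \<in> topspace (prod_topology T (subtopology T C)). (\<lambda>(x, y). f x y) p \<in> topspace T - W}"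
    by (rule closedin_continuous_map_preimage) (use W in blast)
  moreover have "closed_map (prod_topology T (subtopology T C)) T fst"
    by (rule closed_map_fst) (use C in \<open>simp add: compact_space_subtopology\<close>)
  ultimately have "closedin T (fst ` {p \<in> topspace (prod_topology T (subtopology T C)).
      (\<lambda>(x, y). f x y) p \<in> topspace T - W})"
    by (simp add: closed_map_def)
  moreover have "fst ` {p \<in> topspace (prod_topology T (subtopology T C)).
      (\<lambda>(x, y). f x y) p \<in> topspace T - W} = topspace T - {x \<in> carrier G. \<forall>y\<in>C. f x y \<in> W}"
    (is "?L = ?R")
  proof
    show "?L \<subseteq> ?R"
      by auto
    show "?R \<subseteq> ?L"
    proof
      fix x assume x: "x \<in> ?R"
      then obtain y where y: "y \<in> C" "f x y \<notin> W"
        using topspace_eq by auto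
      then have "f x y \<in> topspace T"
        using f x CG by (auto simp: continuous_map_def Pi_iff)
      then show "x \<in> ?L"
        using x y CG by (intro image_eqI[of _ _ "(x, y)"]) auto
    qed
  qed
  ultimately show ?thesis
    by (simp add: closedin_def topspace_eq double_diff)
qed

text \<open>The open normal subgroups form a base of neighbourhoods of the identity. A clopen
  neighbourhood \<open>V\<close> of \<open>\<one>\<close> contains the subgroup \<open>S\<close> of all \<open>x\<close> with \<open>x V \<subseteq> V\<close> and
  \<open>x\<^sup>-\<^sup>1 V \<subseteq> V\<close>. Both \<open>S\<close> and its normal core \<open>K\<close> are open by the tube lemma.\<close>

lemma open_normal_base:
  assumes U: "openin T U" "\<one> \<in> U"
  obtains K where "open_normal K G T" "K \<subseteq> U"
proof -
  have "connected_component_of_set T \<one> = {\<one>}"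
    using totally_disconnected topspace_eq by (simp add: totally_disconnected_space_def)
  then have "{\<one>} \<in> connected_components_of T"
    by (metis connected_component_in_connected_components_of one_closed topspace_eq)
  then obtain V V' where V: "openin T V" "openin T V'" "disjnt V V'" "V \<union> V' = topspace T"
      "\<one> \<in> V" "V \<subseteq> U"
    using wilder_locally_compact_component_thm[of T "{\<one>}" U] compact Hausdorff U topspace_eq
      compact_imp_locally_compact_space by (metis compactin_sing empty_subsetI insert_subset one_closed)
  have "topspace T - V = V'"
    using V by (auto simp: disjnt_iff)
  then have "closedin T V"
    using V openin_subset[OF V(1)] by (simp add: closedin_def)
  then have cV: "compactin T V"
    using compact closedin_compact_space by blast
  have VG: "V \<subseteq> carrier G"
    using V openin_subset topspace_eq by metis
  have fst: "continuous_map (prod_topology T T) T fst" and snd: "continuous_map (prod_topology T T) T snd"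
    by (auto simp: continuous_map_fst continuous_map_snd)
  define S where "S = {x \<in> carrier G. \<forall>v\<in>V. x \<otimes> v \<in> V} \<inter> {x \<in> carrier G. \<forall>v\<in>V. inv x \<otimes> v \<in> V}"
  have "openin T S"
    unfolding S_def
    by (intro openin_Int openin_Ball_compact[OF cV _ V(1)])
      (simp_all add: case_prod_unfold continuous_map_mult continuous_map_m_inv fst snd)
  have S: "subgroup S G"
  proof (rule subgroupI)
    have "\<one> \<in> S"
      using VG by (simp add: S_def subset_iff)
    then show "S \<noteq> {}"
      by blast
    show "inv x \<in> S" if "x \<in> S" for x
      using that by (simp add: S_def)
    show "x \<otimes> y \<in> S" if "x \<in> S" "y \<in> S" for x y
      using that VG by (auto simp: S_def m_assoc inv_mult_group subset_iff)
  qed (auto simp: S_def)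
  have "S \<subseteq> V"
  proof
    fix x assume "x \<in> S"
    then have "x \<otimes> \<one> \<in> V" "x \<in> carrier G"
      using V(5) unfolding S_def by blast+
    then show "x \<in> V"
      by simp
  qed
  define K where "K = {x \<in> carrier G. \<forall>g\<in>carrier G. g \<otimes> x \<otimes> inv g \<in> S}"
  have "openin T K"
    unfolding K_def
    by (intro openin_Ball_compact \<open>openin T S\<close>)
      (use compact in \<open>simp_all add: case_prod_unfold compact_space_def topspace_eq continuous_map_mult continuous_map_m_inv fst snd\<close>)
  have conj_mult: "g \<otimes> (x \<otimes> y) \<otimes> inv g = (g \<otimes> x \<otimes> inv g) \<otimes> (g \<otimes> y \<otimes> inv g)"
    if "g \<in> carrier G" "x \<in> carrier G" "y \<in> carrier G" for g x y
  proof -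
    have "inv g \<otimes> (g \<otimes> (y \<otimes> inv g)) = y \<otimes> inv g"
      using that by (simp add: m_assoc[symmetric])
    then show ?thesis
      using that by (simp add: m_assoc)
  qed
  have conj_inv: "g \<otimes> inv x \<otimes> inv g = inv (g \<otimes> x \<otimes> inv g)"
    if "g \<in> carrier G" "x \<in> carrier G" for g x
    using that by (simp add: inv_mult_group m_assoc)
  have "subgroup K G"
  proof (rule subgroupI)
    have "\<one> \<in> K"
      using subgroup.one_closed[OF S] by (simp add: K_def)
    then show "K \<noteq> {}"
      by blast
    show "inv x \<in> K" if "x \<in> K" for x
      using that S by (simp add: K_def conj_inv subgroup.m_inv_closed)
    show "x \<otimes> y \<in> K" if "x \<in> K" "y \<in> K" for x y
      using that S by (simp add: K_def conj_mult subgroup.m_closed)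
  qed (auto simp: K_def)
  then have "K \<lhd> G"
  proof (rule normal_invI)
    fix x h assume xh: "x \<in> carrier G" "h \<in> K"
    then have h: "h \<in> carrier G"
      by (simp add: K_def)
    have "g \<otimes> (x \<otimes> h \<otimes> inv x) \<otimes> inv g = (g \<otimes> x) \<otimes> h \<otimes> inv (g \<otimes> x)" if "g \<in> carrier G" for g
      using that xh h by (simp add: inv_mult_group m_assoc)
    then show "x \<otimes> h \<otimes> inv x \<in> K"
      using xh h by (simp add: K_def)
  qed
  moreover have "K \<subseteq> U"
  proof
    fix x assume "x \<in> K"
    then have "\<one> \<otimes> x \<otimes> inv \<one> \<in> S" "x \<in> carrier G"
      unfolding K_def using one_closed by blast+
    then show "x \<in> U"
      using \<open>S \<subseteq> V\<close> V(6) by auto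
  qed
  ultimately show thesis
    using that \<open>openin T K\<close> unfolding open_normal_def by blast
qed

lemma open_normal_imp_open_subgroup: "open_normal K G T \<Longrightarrow> open_subgroup K G T"
  by (simp add: open_normal_def open_subgroup_def normal_imp_subgroup)

text \<open>A closed normal subgroup is the intersection of the open normal subgroups above it.\<close>

lemma closed_normal_separation:
  assumes N: "closed_normal N G T" and x: "x \<in> carrier G" "x \<notin> N"
  obtains K where "open_normal K G T" "N \<subseteq> K" "x \<notin> K"
proof -
  \<comment> \<open>if \<open>x L\<close> misses \<open>N\<close> for an open normal \<open>L\<close>, then \<open>x\<close> is not in \<open>N L\<close>\<close>
  define U where "U = {u \<in> topspace T. x \<otimes> u \<in> topspace T - N}"
  have "continuous_map T T (\<lambda>u. x \<otimes> u)"
    using x by (intro continuous_map_group) auto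
  then have "openin T U"
    unfolding U_def by (rule openin_continuous_map_preimage) (use N in \<open>auto simp: closed_normal_def\<close>)
  moreover have "\<one> \<in> U"
    using x by (simp add: U_def topspace_eq)
  ultimately obtain L where L: "open_normal L G T" "L \<subseteq> U"
    using open_normal_base by blast
  have sub: "subgroup L G" "subgroup N G" "N \<lhd> G" "L \<lhd> G"
    using L N by (auto simp: open_normal_def closed_normal_def normal_imp_subgroup)
  have NL: "N <#> L \<lhd> G"
    using sub by (intro normal_subgroup_set_mult_closed)
  have "L \<subseteq> N <#> L"
    using sub subgroup.one_closed[of N] subgroup.mem_carrier[of L]
    by (force simp: set_mult_def)
  then have "openin T (N <#> L)"
    using openin_supergroup[OF open_normal_imp_open_subgroup[OF L(1)] normal_imp_subgroup[OF NL]] by simp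
  moreover have "N \<subseteq> N <#> L"
    using sub subgroup.one_closed[of L] subgroup.mem_carrier[of N]
    by (force simp: set_mult_def)
  moreover have "x \<notin> N <#> L"
  proof
    assume "x \<in> N <#> L"
    then obtain n l where nl: "n \<in> N" "l \<in> L" "x = n \<otimes> l"
      by (auto simp: set_mult_def)
    then have "inv l \<in> U" "n \<in> carrier G" "l \<in> carrier G"
      using L sub by (auto simp: subgroup.m_inv_closed subgroup.mem_carrier)
    then show False
      using nl by (auto simp: U_def m_assoc)
  qed
  ultimately show thesis
    using that NL by (auto simp: open_normal_def)
qed

lemma closed_normal_one: "closed_normal {\<one>} G T"
  using Hausdorff by (simp add: closed_normal_def one_is_normal closedin_Hausdorff_singleton topspace_eq)

lemma open_subgroup_carrier: "open_subgroup (carrier G) G T"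
  using openin_topspace[of T] by (simp add: open_subgroup_def subgroup_self topspace_eq)

lemma open_normal_Int:
  "open_normal K G T \<Longrightarrow> open_normal L G T \<Longrightarrow> open_normal (K \<inter> L) G T"
  by (simp add: open_normal_def normal_subgroup_intersect openin_Int)

end

text \<open>Among closed sets of a compact space, one member of a downward directed family lies in any
  given open set that contains the intersection.\<close>

lemma compact_directed_Inter_subset:
  assumes "compact_space Z" and ne: "I \<noteq> {}" and clo: "\<And>i. i \<in> I \<Longrightarrow> closedin Z (F i)"
    and dir: "\<And>i j. i \<in> I \<Longrightarrow> j \<in> I \<Longrightarrow> \<exists>k\<in>I. F k \<subseteq> F i \<inter> F j"
    and U: "openin Z U" "(\<Inter>i\<in>I. F i) \<subseteq> U"
  obtains i where "i \<in> I" "F i \<subseteq> U"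
proof -
  have below: "\<exists>k\<in>I. F k \<subseteq> \<Inter>\<A>" if "finite \<A>" "\<A> \<subseteq> F ` I" for \<A>
    using that
  proof (induction \<A>)
    case empty
    then show ?case using ne by auto
  next
    case (insert A \<A>)
    then obtain i j where "i \<in> I" "j \<in> I" "A = F i" "F j \<subseteq> \<Inter>\<A>"
      by auto
    then show ?case
      using dir[of i j] by auto
  qed
  have "\<exists>i\<in>I. F i \<subseteq> U"
  proof (rule ccontr)
    assume no: "\<not> (\<exists>i\<in>I. F i \<subseteq> U)"
    define C where "C = topspace Z - U"
    have cC: "compactin Z C"
      unfolding C_def using assms(1) U(1) by (intro closedin_compact_space) auto
    have "C \<inter> \<Inter>\<A> \<noteq> {}" if fin: "finite \<A>" "\<A> \<subseteq> F ` I" for \<A>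
    proof -
      obtain k where "k \<in> I" "F k \<subseteq> \<Inter>\<A>"
        using below[OF fin] by blast
      moreover have "F k \<subseteq> topspace Z"
        by (rule closedin_subset[OF clo[OF \<open>k \<in> I\<close>]])
      ultimately show ?thesis
        using no unfolding C_def by blast
    qed
    moreover have "\<forall>A\<in>F ` I. closedin Z A"
      using clo by blast
    ultimately have "C \<inter> \<Inter>(F ` I) \<noteq> {}"
      using cC[unfolded compactin_fip, THEN conjunct2, rule_format, of "F ` I"] by blast
    then show False
      using U(2) by (auto simp: C_def)
  qed
  then show thesis
    using that by blast
qed

section \<open>Quotients and open subgroups of profinite groups\<close>

lemma clopen_separation_imp_totally_disconnected:
  assumes "\<And>x y. x \<in> topspace Z \<Longrightarrow> y \<in> topspace Z \<Longrightarrow> x \<noteq> y \<Longrightarrow>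
      \<exists>C. openin Z C \<and> closedin Z C \<and> x \<notin> C \<and> y \<in> C"
  shows "Hausdorff_space Z" "totally_disconnected_space Z"
proof -
  show "Hausdorff_space Z"
    unfolding Hausdorff_space_def
  proof (intro allI impI)
    fix x y assume "x \<in> topspace Z \<and> y \<in> topspace Z \<and> x \<noteq> y"
    then obtain C where C: "openin Z C" "closedin Z C" "x \<notin> C" "y \<in> C" "x \<in> topspace Z"
      using assms by blast
    then show "\<exists>U V. openin Z U \<and> openin Z V \<and> x \<in> U \<and> y \<in> V \<and> disjnt U V"
      by (intro exI[of _ "topspace Z - C"] exI[of _ C]) (auto simp: disjnt_iff)
  qed
  show "totally_disconnected_space Z"
    unfolding totally_disconnected_space_def
  proof
    fix x assume x: "x \<in> topspace Z"
    have "y = x" if y: "connected_component_of Z x y" for y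
    proof (rule ccontr)
      assume "y \<noteq> x"
      obtain A where A: "connectedin Z A" "x \<in> A" "y \<in> A"
        using y unfolding connected_component_of_def by blast
      have "y \<in> topspace Z"
        using A connectedin_subset_topspace by blast
      then obtain C where "openin Z C" "closedin Z C" "x \<notin> C" "y \<in> C"
        using assms[OF x] \<open>y \<noteq> x\<close> by blast
      then show False
        using connectedin_clopen_cases[OF A(1), of C] A by (auto simp: disjnt_iff)
    qed
    then show "connected_component_of_set Z x = {x}"
      using x by (auto simp: connected_component_of_refl)
  qed
qed

context profinite
begin

lemma profinite_open_subgroup:
  assumes H: "open_subgroup H G T"
  shows "profinite_group (G\<lparr>carrier := H\<rparr>) (subtopology T H)"
proof -
  have sub: "subgroup H G"
    using H by (simp add: open_subgroup_def)
  have HG: "H \<subseteq> topspace T"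
    using subgroup.subset[OF sub] topspace_eq by simp
  then have top: "topspace (subtopology T H) = H"
    by auto
  have into: "continuous_map Z T f" if "continuous_map Z (subtopology T H) f" for Z :: "'c topology" and f
    using that by (simp add: continuous_map_in_subtopology)
  have "continuous_map (prod_topology (subtopology T H) (subtopology T H)) (subtopology T H) (\<lambda>(x, y). x \<otimes> y)"
    unfolding continuous_map_in_subtopology case_prod_unfold
  proof
    show "continuous_map (prod_topology (subtopology T H) (subtopology T H)) T (\<lambda>p. fst p \<otimes> snd p)"
      by (intro continuous_map_mult) (simp_all add: continuous_map_from_subtopology_mono continuous_map_into_fulltopology[OF continuous_map_fst] continuous_map_into_fulltopology[OF continuous_map_snd])
    show "(\<lambda>p. fst p \<otimes> snd p) \<in> topspace (prod_topology (subtopology T H) (subtopology T H)) \<rightarrow> H"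
      using subgroup.m_closed[OF sub] by auto
  qed
  moreover have "continuous_map (subtopology T H) (subtopology T H) (\<lambda>x. inv\<^bsub>G\<lparr>carrier := H\<rparr>\<^esub> x)"
  proof (rule continuous_map_eq)
    show "continuous_map (subtopology T H) (subtopology T H) (\<lambda>x. inv x)"
      unfolding continuous_map_in_subtopology
      using subgroup.m_inv_closed[OF sub]
      by (auto intro!: continuous_map_m_inv continuous_map_from_subtopology)
  qed (use top m_inv_consistent[OF sub] in simp)
  ultimately have "topological_group (G\<lparr>carrier := H\<rparr>) (subtopology T H)"
    unfolding topological_group_def using top subgroup_imp_group[OF sub] by simp
  moreover have "compact_space (subtopology T H)"
    using closedin_compact_space[OF compact closedin_open_subgroup[OF H]]
    by (simp add: compact_space_subtopology)
  moreover have "totally_disconnected_space (subtopology T H)"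
    unfolding totally_disconnected_space_def
  proof
    fix x assume x: "x \<in> topspace (subtopology T H)"
    have "connected_component_of T x y" if "connected_component_of (subtopology T H) x y" for y
      using connected_component_of_mono[OF that, of UNIV] by simp
    then show "connected_component_of_set (subtopology T H) x = {x}"
      using totally_disconnected x HG connected_component_of_refl[of "subtopology T H" x]
      unfolding totally_disconnected_space_def top by blast
  qed
  ultimately show ?thesis
    by (simp add: profinite_group_def Hausdorff_space_subtopology Hausdorff)
qed

lemma quotient_map_coset: "quotient_map T (quotient_topology G T N) (\<lambda>x. N #> x)"
  by (rule quotient_map_quotient_topology[OF topspace_eq])

lemma open_map_coset:
  assumes N: "N \<lhd> G" and U: "openin T U"
  shows "openin (quotient_topology G T N) ((\<lambda>x. N #> x) ` U)"
  unfolding openin_quotient_topology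
proof
  have sub: "subgroup N G"
    using N by (rule normal_imp_subgroup)
  have UG: "U \<subseteq> carrier G"
    using openin_subset[OF U] topspace_eq by simp
  then show "(\<lambda>x. N #> x) ` U \<subseteq> carrier (G Mod N)"
    by (auto simp: carrier_FactGroup)
  have "{x \<in> topspace T. N #> x \<in> (\<lambda>x. N #> x) ` U} = (\<Union>n\<in>N. {x \<in> topspace T. n \<otimes> x \<in> U})"
  proof (intro equalityI subsetI)
    fix x assume "x \<in> {x \<in> topspace T. N #> x \<in> (\<lambda>x. N #> x) ` U}"
    then obtain u where u: "u \<in> U" "N #> x = N #> u" "x \<in> carrier G"
      using topspace_eq by auto
    then have "u \<in> N #> x"
      using rcos_self[OF _ sub, of u] UG by blast
    then show "x \<in> (\<Union>n\<in>N. {x \<in> topspace T. n \<otimes> x \<in> U})"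
      using u topspace_eq by (auto simp: r_coset_def)
  next
    fix x assume "x \<in> (\<Union>n\<in>N. {x \<in> topspace T. n \<otimes> x \<in> U})"
    then obtain n where n: "n \<in> N" "x \<in> carrier G" "n \<otimes> x \<in> U"
      using topspace_eq by auto
    then have "n \<otimes> x \<in> N #> x"
      by (auto simp: r_coset_def)
    then have "N #> x = N #> (n \<otimes> x)"
      using n sub by (intro repr_independence)
    then show "x \<in> {x \<in> topspace T. N #> x \<in> (\<lambda>x. N #> x) ` U}"
      using n topspace_eq by auto
  qed
  moreover have "openin T {x \<in> topspace T. n \<otimes> x \<in> U}" if "n \<in> N" for n
  proof (rule openin_continuous_map_preimage[OF _ U])
    show "continuous_map T T (\<lambda>x. n \<otimes> x)"
      using subgroup.mem_carrier[OF sub that] by (intro continuous_map_group) auto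
  qed
  ultimately show "openin T {x \<in> topspace T. N #> x \<in> (\<lambda>x. N #> x) ` U}"
    by auto
qed

lemma profinite_quotient:
  assumes N: "closed_normal N G T"
  shows "profinite_group (G Mod N) (quotient_topology G T N)"
proof -
  let ?Q = "quotient_topology G T N" and ?q = "\<lambda>x. N #> x"
  have nor: "N \<lhd> G"
    using N by (simp add: closed_normal_def)
  then interpret normal N G .
  have top: "topspace ?Q = carrier (G Mod N)"
    by (rule topspace_quotient_topology[OF topspace_eq])
  have q: "quotient_map T ?Q ?q"
    by (rule quotient_map_coset)
  have cont: "continuous_map T ?Q ?q"
    by (rule quotient_imp_continuous_map[OF q])
  have "continuous_map (prod_topology ?Q ?Q) ?Q (\<lambda>(x, y). x <#> y)"
    unfolding continuous_map
  proof (intro conjI allI impI)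
    show "(\<lambda>(x, y). x <#> y) ` topspace (prod_topology ?Q ?Q) \<subseteq> topspace ?Q"
      using group.is_monoid[OF factorgroup_is_group] monoid.m_closed[of "G Mod N"] by (auto simp: top)
    fix W assume W: "openin ?Q W"
    let ?P = "{p \<in> topspace (prod_topology ?Q ?Q). (case p of (x, y) \<Rightarrow> x <#> y) \<in> W}"
    let ?R = "{p \<in> topspace (prod_topology T T). ?q (fst p \<otimes> snd p) \<in> W}"
    have mult: "continuous_map (prod_topology T T) ?Q (?q \<circ> (\<lambda>p. fst p \<otimes> snd p))"
      by (intro continuous_map_compose[OF _ cont] continuous_map_mult)
        (simp_all add: continuous_map_fst continuous_map_snd)
    have R: "openin (prod_topology T T) ?R"
      using openin_continuous_map_preimage[OF mult W] unfolding o_def .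
    show "openin (prod_topology ?Q ?Q) ?P"
      unfolding openin_prod_topology_alt
    proof (intro allI impI)
      fix a b assume ab: "(a, b) \<in> ?P"
      then obtain x y where xy: "x \<in> carrier G" "y \<in> carrier G" "a = ?q x" "b = ?q y"
        by (auto simp: top carrier_FactGroup)
      then have "(x, y) \<in> ?R"
        using ab by (simp add: topspace_eq rcos_sum)
      then obtain U V where UV: "openin T U" "openin T V" "x \<in> U" "y \<in> V" "U \<times> V \<subseteq> ?R"
        using R unfolding openin_prod_topology_alt by meson
      have "?q ` U \<times> ?q ` V \<subseteq> ?P"
      proof clarify
        fix u v assume uv: "u \<in> U" "v \<in> V"
        then have "(u, v) \<in> ?R"
          using UV(5) by blast
        then show "(?q u, ?q v) \<in> topspace (prod_topology ?Q ?Q) \<and> ?q u <#> ?q v \<in> W"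
          by (auto simp: topspace_eq rcos_sum top carrier_FactGroup)
      qed
      then show "\<exists>U V. openin ?Q U \<and> openin ?Q V \<and> a \<in> U \<and> b \<in> V \<and> U \<times> V \<subseteq> ?P"
        using UV xy by (intro exI[of _ "?q ` U"] exI[of _ "?q ` V"]) (simp add: open_map_coset[OF nor])
    qed
  qed
  moreover have "continuous_map ?Q ?Q (\<lambda>x. inv\<^bsub>G Mod N\<^esub> x)"
  proof (rule continuous_compose_quotient_map[OF q])
    show "continuous_map T ?Q ((\<lambda>x. inv\<^bsub>G Mod N\<^esub> x) \<circ> ?q)"
    proof (rule continuous_map_eq)
      show "continuous_map T ?Q (?q \<circ> (\<lambda>x. inv x))"
        by (rule continuous_map_compose[OF continuous_map_m_inv[OF continuous_map_id[unfolded id_def]] cont])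
      fix x assume "x \<in> topspace T"
      then show "(?q \<circ> (\<lambda>x. inv x)) x = ((\<lambda>x. inv\<^bsub>G Mod N\<^esub> x) \<circ> ?q) x"
        using topspace_eq by (simp add: inv_FactGroup carrier_FactGroup rcos_inv)
    qed
  qed
  ultimately have "topological_group (G Mod N) ?Q"
    by (simp add: topological_group_def factorgroup_is_group top)
  moreover have "compact_space ?Q"
    using image_compactin[of T "topspace T" ?Q ?q] compact cont quotient_imp_surjective_map[OF q]
    by (simp add: compact_space_def)
  moreover have "\<exists>C. openin ?Q C \<and> closedin ?Q C \<and> a \<notin> C \<and> b \<in> C"
    if ab: "a \<in> topspace ?Q" "b \<in> topspace ?Q" "a \<noteq> b" for a b
  proof -
    obtain x y where xy: "x \<in> carrier G" "y \<in> carrier G" "a = ?q x" "b = ?q y"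
      using ab by (auto simp: top carrier_FactGroup)
    have xyG: "x \<otimes> inv y \<in> carrier G"
      using xy by simp
    have "x \<otimes> inv y \<notin> N"
    proof
      assume "x \<otimes> inv y \<in> N"
      then have "x \<in> N #> y"
        using rcos_module[OF is_group xy(2,1)] by simp
      then show False
        using repr_independence[OF _ xy(2) subgroup_axioms, of x] xy ab by simp
    qed
    then obtain K where K: "open_normal K G T" "N \<subseteq> K" "x \<otimes> inv y \<notin> K"
      using closed_normal_separation[OF N xyG] by metis
    have KG: "subgroup K G" "openin T K"
      using K by (auto simp: open_normal_def normal_imp_subgroup)
    let ?C = "?q ` (K #> y)"
    have KyG: "K #> y \<subseteq> carrier G"
      by (intro r_coset_subset_G subgroup.subset[OF KG(1)] xy)
    \<comment> \<open>the preimage of the image of \<open>K y\<close> is \<open>K y\<close>, because \<open>N \<subseteq> K\<close>\<close>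
    have eq: "z \<in> K #> y" if z: "z \<in> carrier G" "?q z \<in> ?C" for z
    proof -
      obtain w where w: "w \<in> K #> y" "?q z = ?q w"
        using z by blast
      then have "z \<in> N #> w"
        using rcos_self[OF z(1) subgroup_axioms] by simp
      then have "z \<in> K #> w"
        using K(2) by (auto simp: r_coset_def)
      moreover have "K #> w = K #> y"
        using repr_independence[OF w(1) xy(2) KG(1)] by simp
      ultimately show ?thesis by simp
    qed
    have "openin ?Q ?C"
      by (intro open_map_coset nor openin_r_coset KG xy)
    moreover have "openin ?Q (topspace ?Q - ?C)"
      unfolding openin_quotient_topology
    proof
      have "{z \<in> topspace T. ?q z \<in> topspace ?Q - ?C} = topspace T - (K #> y)"
        using eq by (auto simp: topspace_eq top carrier_FactGroup)
      then show "openin T {z \<in> topspace T. ?q z \<in> topspace ?Q - ?C}"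
        using closedin_r_coset[OF closedin_open_subgroup[OF open_normal_imp_open_subgroup[OF K(1)]] xy(2)]
        by auto
    qed (auto simp: top)
    moreover have "?C \<subseteq> topspace ?Q"
      using KyG by (auto simp: top carrier_FactGroup)
    moreover have "b \<in> ?C"
      using rcos_self[OF xy(2) KG(1)] xy by blast
    moreover have "a \<notin> ?C"
    proof
      assume "a \<in> ?C"
      then have "x \<in> K #> y"
        using eq xy by blast
      then show False
        using K(3) subgroup.rcos_module[OF KG(1) is_group xy(2,1)] by blast
    qed
    ultimately show ?thesis
      by (auto simp: closedin_def)
  qed
  ultimately show ?thesis
    unfolding profinite_group_def using clopen_separation_imp_totally_disconnected[of ?Q] by blast
qed

end

section \<open>Obliquity relative to a closed normal subgroup\<close>

text \<open>The intersection of \<open>G\<close> with the open normal subgroups of index at most \<open>n\<close> that contain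
  \<open>M\<close>.\<close>

definition I_above :: "('a, 'm) monoid_scheme \<Rightarrow> 'a topology \<Rightarrow> 'a set \<Rightarrow> nat \<Rightarrow> 'a set" where
  "I_above G T M n =
     carrier G \<inter> \<Inter>{K. open_normal K G T \<and> M \<subseteq> K \<and> subgroup_index G K \<le> enat n}"

text \<open>Both obliquity functions are handled at once: the flag \<open>s\<close> selects the variant for
  subgroups normalised by \<open>H\<close> (true) or by the whole group (false). Only subgroups that contain
  \<open>M\<close> are used; when \<open>M\<close> is normal, these are the preimages in \<open>G\<close> of the subgroups of \<open>G / M\<close>.
  For \<open>M = {\<one>}\<close> the restriction is void.\<close>

definition Ob_above :: "bool \<Rightarrow> ('a, 'm) monoid_scheme \<Rightarrow> 'a topology \<Rightarrow> 'a set \<Rightarrow> 'a set \<Rightarrow> 'a set" where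
  "Ob_above s G T M H =
     H \<inter> \<Inter>{K. open_subgroup K G T \<and> M \<subseteq> K \<and>
       (if s then H else carrier G) \<subseteq> normalizer G K \<and> \<not> K \<subseteq> H}"

text \<open>The obliquity subgroup for the index bound \<open>n\<close>, relative to \<open>M\<close>.\<close>

definition OI_above :: "bool \<Rightarrow> ('a, 'm) monoid_scheme \<Rightarrow> 'a topology \<Rightarrow> 'a set \<Rightarrow> nat \<Rightarrow> 'a set" where
  "OI_above s G T M n = Ob_above s G T M (I_above G T M n)"

text \<open>The class of profinite groups whose obliquity function of kind \<open>s\<close> is bounded by \<open>\<eta>\<close>.\<close>

definition bounded_obliquity ::
    "bool \<Rightarrow> (nat \<Rightarrow> nat) \<Rightarrow> ('a, 'm) monoid_scheme \<Rightarrow> 'a topology \<Rightarrow> bool" where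
  "bounded_obliquity s \<eta> G T \<longleftrightarrow> profinite_group G T \<and>
     (\<forall>n\<ge>1. subgroup_index G (OI_above s G T {\<one>\<^bsub>G\<^esub>} n) \<le> enat (\<eta> n))"

context group
begin

lemma OI_above_one:
  "I_above G T {\<one>} n = I_normal G T n"
  "OI_above False G T {\<one>} n = OI G T n"
  "OI_above True G T {\<one>} n = OI_star G T n"
proof -
  have one: "\<one> \<in> K" if "subgroup K G" for K
    using that by (rule subgroup.one_closed)
  have one': "\<one> \<in> K" if "open_normal K G T" for K
    using that by (simp add: open_normal_def normal_imp_subgroup one)
  show I: "I_above G T {\<one>} n = I_normal G T n"
    unfolding I_above_def I_normal_def using one' by (auto 0 3)
  have "open_subgroup K G T \<and> {\<one>} \<subseteq> K \<and> carrier G \<subseteq> normalizer G K \<and> \<not> K \<subseteq> H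
      \<longleftrightarrow> open_normal K G T \<and> \<not> K \<subseteq> H" for K H
    using one by (auto simp: open_subgroup_def open_normal_def normal_iff_subset_normalizer)
  then show "OI_above False G T {\<one>} n = OI G T n"
    by (simp add: OI_above_def OI_def Ob_above_def Ob_def I)
  have "open_subgroup K G T \<and> {\<one>} \<subseteq> K \<and> H \<subseteq> normalizer G K \<and> \<not> K \<subseteq> H
      \<longleftrightarrow> open_subgroup K G T \<and> H \<subseteq> normalizer G K \<and> \<not> K \<subseteq> H" for K H
    using one by (auto simp: open_subgroup_def)
  then show "OI_above True G T {\<one>} n = OI_star G T n"
    by (simp add: OI_above_def OI_star_def Ob_above_def Ob_star_def I)
qed

lemma subgroup_I_above: "subgroup (I_above G T M n) G"
proof -
  have "I_above G T M n = \<Inter>(insert (carrier G) {K. open_normal K G T \<and> M \<subseteq> K \<and> subgroup_index G K \<le> enat n})"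
    by (simp add: I_above_def)
  also have "subgroup \<dots> G"
    by (rule subgroups_Inter) (auto simp: subgroup_self open_normal_def normal_imp_subgroup)
  finally show ?thesis .
qed

lemma subgroup_Ob_above:
  assumes "subgroup H G" shows "subgroup (Ob_above s G T M H) G"
proof -
  have "Ob_above s G T M H = \<Inter>(insert H {K. open_subgroup K G T \<and> M \<subseteq> K \<and>
       (if s then H else carrier G) \<subseteq> normalizer G K \<and> \<not> K \<subseteq> H})"
    by (simp add: Ob_above_def)
  also have "subgroup \<dots> G"
    using assms by (intro subgroups_Inter) (auto simp: open_subgroup_def)
  finally show ?thesis .
qed

lemma subgroup_OI_above: "subgroup (OI_above s G T M n) G"
  by (simp add: OI_above_def subgroup_Ob_above subgroup_I_above)

lemma I_above_mono: "M \<subseteq> M' \<Longrightarrow> I_above G T M n \<subseteq> I_above G T M' n"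
  unfolding I_above_def by blast

lemma Ob_above_mono:
  assumes "M \<subseteq> M'" "H \<subseteq> H'"
  shows "Ob_above s G T M H \<subseteq> Ob_above s G T M' H'"
proof
  fix x assume x: "x \<in> Ob_above s G T M H"
  have *: "x \<in> K" if "open_subgroup K G T" "M' \<subseteq> K" "(if s then H' else carrier G) \<subseteq> normalizer G K"
    "\<not> K \<subseteq> H'" for K
  proof -
    have "M \<subseteq> K" "(if s then H else carrier G) \<subseteq> normalizer G K" "\<not> K \<subseteq> H"
      using that assms by (auto split: if_splits)
    then show ?thesis
      using x that(1) unfolding Ob_above_def by blast
  qed
  show "x \<in> Ob_above s G T M' H'"
    unfolding Ob_above_def
  proof (intro IntI InterI)
    show "x \<in> H'"
      using x assms(2) by (auto simp: Ob_above_def)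
  qed (elim CollectE conjE, rule *)
qed

lemma OI_above_mono: "M \<subseteq> M' \<Longrightarrow> OI_above s G T M n \<subseteq> OI_above s G T M' n"
  unfolding OI_above_def by (intro Ob_above_mono I_above_mono)

end

lemma bounded_obliquity_eq:
  "bounded_obliquity False = (O_class :: _ \<Rightarrow> ('a, 'm) monoid_scheme \<Rightarrow> _)"
  "bounded_obliquity True = (O_star_class :: _ \<Rightarrow> ('a, 'm) monoid_scheme \<Rightarrow> _)"
proof -
  show "bounded_obliquity False = (O_class :: _ \<Rightarrow> ('a, 'm) monoid_scheme \<Rightarrow> _)"
  proof (intro ext)
    fix \<eta> and G :: "('a, 'm) monoid_scheme" and T
    have "group G" if "profinite_group G T"
      using that by (simp add: profinite_group_def topological_group_def)
    then show "bounded_obliquity False \<eta> G T = O_class \<eta> G T"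
      by (cases "profinite_group G T")
        (simp_all add: bounded_obliquity_def O_class_def ob_def group.OI_above_one)
  qed
  show "bounded_obliquity True = (O_star_class :: _ \<Rightarrow> ('a, 'm) monoid_scheme \<Rightarrow> _)"
  proof (intro ext)
    fix \<eta> and G :: "('a, 'm) monoid_scheme" and T
    have "group G" if "profinite_group G T"
      using that by (simp add: profinite_group_def topological_group_def)
    then show "bounded_obliquity True \<eta> G T = O_star_class \<eta> G T"
      by (cases "profinite_group G T")
        (simp_all add: bounded_obliquity_def O_star_class_def ob_star_def group.OI_above_one)
  qed
qed

section \<open>Images\<close>

text \<open>A continuous epimorphism \<open>h\<close> between profinite groups.\<close>

locale profinite_epi = dom: profinite G T + cod: profinite H S
  for G (structure) and T and H (structure) and S +
  fixes h
  assumes hom: "h \<in> hom G H" and cont: "continuous_map T S h" and surj: "h ` carrier G = carrier H"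
begin

sublocale group_hom G H h
  by (simp add: group_hom_def group_hom_axioms_def hom dom.is_group cod.is_group)

text \<open>The preimage of a set under \<open>h\<close>, within the carrier of \<open>G\<close>.\<close>

definition preim :: "'c set \<Rightarrow> 'a set" where
  "preim A = {x \<in> carrier G. h x \<in> A}"

lemma image_preim: "A \<subseteq> carrier H \<Longrightarrow> h ` preim A = A"
  using surj by (auto simp: preim_def)

lemma preim_subset_iff:
  assumes "A \<subseteq> carrier H"
  shows "preim A \<subseteq> preim B \<longleftrightarrow> A \<subseteq> B"
proof
  assume "preim A \<subseteq> preim B"
  then have "h ` preim A \<subseteq> B"
    by (auto simp: preim_def)
  then show "A \<subseteq> B"
    by (simp add: image_preim assms)
qed (auto simp: preim_def)

lemma preim_carrier: "preim (carrier H) = carrier G"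
  by (auto simp: preim_def)

lemma subgroup_preim: "subgroup A H \<Longrightarrow> subgroup (preim A) G"
  by (rule dom.subgroupI) (auto simp: preim_def subgroup.m_closed subgroup.m_inv_closed subgroup.one_closed intro!: exI[of _ "\<one>\<^bsub>G\<^esub>"])

lemma kernel_subset_preim: "subgroup A H \<Longrightarrow> kernel G H h \<subseteq> preim A"
  by (auto simp: kernel_def preim_def subgroup.one_closed)

lemma preim_image:
  assumes K: "subgroup K G" and "kernel G H h \<subseteq> K"
  shows "preim (h ` K) = K"
proof
  show "preim (h ` K) \<subseteq> K"
  proof
    fix x assume "x \<in> preim (h ` K)"
    then obtain k where k: "x \<in> carrier G" "k \<in> K" "h x = h k"
      by (auto simp: preim_def)
    have kG: "k \<in> carrier G"
      using subgroup.mem_carrier[OF K k(2)] .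
    then have "x \<otimes> inv k \<in> kernel G H h"
      using k by (simp add: kernel_def)
    then have "(x \<otimes> inv k) \<otimes> k \<in> K"
      by (rule subgroup.m_closed[OF K subsetD[OF assms(2)] k(2)])
    then show "x \<in> K"
      using k kG by (simp add: dom.m_assoc)
  qed
  show "K \<subseteq> preim (h ` K)"
    using subgroup.subset[OF K] by (auto simp: preim_def)
qed

lemma open_subgroup_preim:
  assumes "open_subgroup K H S" shows "open_subgroup (preim K) G T"
  using assms subgroup_preim openin_continuous_map_preimage[OF cont, of K]
  by (simp add: open_subgroup_def preim_def dom.topspace_eq)

lemma open_subgroup_image:
  assumes "open_subgroup K G T" "kernel G H h \<subseteq> K"
  shows "open_subgroup (h ` K) H S"
proof -
  have K: "subgroup K G" "openin T K"
    using assms by (auto simp: open_subgroup_def)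
  have "closedin T (topspace T - K)"
    using K by blast
  then have "closedin S (h ` (topspace T - K))"
    using continuous_imp_closed_map[OF cont dom.compact cod.Hausdorff] by (simp add: closed_map_def)
  moreover have "topspace S - h ` (topspace T - K) = h ` K"
  proof
    show "topspace S - h ` (topspace T - K) \<subseteq> h ` K"
      using surj by (auto simp: dom.topspace_eq cod.topspace_eq)
    show "h ` K \<subseteq> topspace S - h ` (topspace T - K)"
    proof clarify
      fix k assume k: "k \<in> K"
      have "h k \<notin> h ` (topspace T - K)"
      proof
        assume "h k \<in> h ` (topspace T - K)"
        then obtain x where x: "x \<in> carrier G" "x \<notin> K" "h x = h k"
          by (auto simp: dom.topspace_eq)
        then have "x \<in> preim (h ` K)"
          using k by (auto simp: preim_def)
        then show False
          using preim_image[OF K(1) assms(2)] x by simp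
      qed
      moreover have "h k \<in> topspace S"
        using subgroup.mem_carrier[OF K(1) k] by (simp add: cod.topspace_eq)
      ultimately show "h k \<in> topspace S - h ` (topspace T - K)"
        by blast
    qed
  qed
  ultimately have "openin S (h ` K)"
    by (metis openin_diff openin_topspace)
  then show ?thesis
    using subgroup_img_is_subgroup[OF K(1)] by (simp add: open_subgroup_def)
qed

lemma subset_normalizer_preim:
  assumes A: "subgroup A H" and K: "subgroup K H"
  shows "preim A \<subseteq> normalizer G (preim K) \<longleftrightarrow> A \<subseteq> normalizer H K"
proof -
  have "(\<forall>s\<in>preim A. \<forall>k\<in>preim K. s \<otimes> k \<otimes> inv s \<in> preim K) \<longleftrightarrow>
      (\<forall>s\<in>preim A. \<forall>k\<in>preim K. h s \<otimes>\<^bsub>H\<^esub> h k \<otimes>\<^bsub>H\<^esub> inv\<^bsub>H\<^esub> h s \<in> K)"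
    by (auto simp: preim_def)
  also have "\<dots> \<longleftrightarrow> (\<forall>s\<in>h ` preim A. \<forall>k\<in>h ` preim K. s \<otimes>\<^bsub>H\<^esub> k \<otimes>\<^bsub>H\<^esub> inv\<^bsub>H\<^esub> s \<in> K)"
    by blast
  finally show ?thesis
    using subgroup.subset[OF K] subgroup.subset[OF A] subgroup.subset[OF subgroup_preim[OF K]]
    by (simp add: dom.subset_normalizer_iff[OF subgroup_preim[OF A]] cod.subset_normalizer_iff[OF A] image_preim)
qed

lemma open_normal_preim_iff:
  assumes "subgroup K H"
  shows "open_normal (preim K) G T \<longleftrightarrow> open_normal K H S"
proof -
  have "openin S K" if "openin T (preim K)"
    using that open_subgroup_image[of "preim K"] subgroup_preim[OF assms] kernel_subset_preim[OF assms]
      image_preim[OF subgroup.subset[OF assms]] by (simp add: open_subgroup_def)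
  then show ?thesis
    using open_subgroup_preim[of K] subset_normalizer_preim[OF cod.subgroup_self assms] assms subgroup_preim[OF assms]
    by (auto simp: open_normal_def open_subgroup_def dom.normal_iff_subset_normalizer
        cod.normal_iff_subset_normalizer preim_carrier)
qed

lemma preim_r_coset:
  assumes "A \<subseteq> carrier H" "x \<in> carrier G"
  shows "preim (A #>\<^bsub>H\<^esub> h x) = preim A #> x"
proof (intro equalityI subsetI)
  fix y assume "y \<in> preim (A #>\<^bsub>H\<^esub> h x)"
  then obtain a where a: "y \<in> carrier G" "a \<in> A" "h y = a \<otimes>\<^bsub>H\<^esub> h x"
    by (auto simp: preim_def r_coset_def)
  then have "a \<in> carrier H"
    using assms by blast
  then have "h (y \<otimes> inv x) = a"
    using a assms by (simp add: cod.m_assoc)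
  then have "y \<otimes> inv x \<in> preim A"
    using a assms by (simp add: preim_def)
  moreover have "y = (y \<otimes> inv x) \<otimes> x"
    using a assms by (simp add: dom.m_assoc)
  ultimately show "y \<in> preim A #> x"
    unfolding r_coset_def by blast
next
  fix y assume "y \<in> preim A #> x"
  then show "y \<in> preim (A #>\<^bsub>H\<^esub> h x)"
    using assms by (auto simp: preim_def r_coset_def)
qed

lemma subgroup_index_preim:
  assumes A: "A \<subseteq> carrier H"
  shows "subgroup_index G (preim A) = subgroup_index H A"
proof -
  have "rcosets (preim A) = (\<lambda>x. preim (A #>\<^bsub>H\<^esub> h x)) ` carrier G"
    unfolding RCOSETS_def using preim_r_coset[OF A] by auto
  also have "\<dots> = (\<lambda>y. preim (A #>\<^bsub>H\<^esub> y)) ` h ` carrier G"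
    by (simp add: image_image)
  also have "\<dots> = preim ` (rcosets\<^bsub>H\<^esub> A)"
    unfolding RCOSETS_def surj by auto
  finally have eq: "rcosets (preim A) = preim ` (rcosets\<^bsub>H\<^esub> A)" .
  have "B \<subseteq> carrier H" if "B \<in> rcosets\<^bsub>H\<^esub> A" for B
    using that A cod.r_coset_subset_G by (auto simp: RCOSETS_def)
  then have "inj_on preim (rcosets\<^bsub>H\<^esub> A)"
    by (intro inj_onI) (metis image_preim)
  then show ?thesis
    unfolding subgroup_index_def eq by (simp add: card_image finite_image_iff)
qed

lemma preim_I_above: "preim (I_above H S {\<one>\<^bsub>H\<^esub>} n) = I_above G T (kernel G H h) n"
proof (intro equalityI subsetI)
  fix x assume x: "x \<in> preim (I_above H S {\<one>\<^bsub>H\<^esub>} n)"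
  have "x \<in> K" if K: "open_normal K G T" "kernel G H h \<subseteq> K" "subgroup_index G K \<le> enat n" for K
  proof -
    have sub: "subgroup K G"
      using K by (simp add: open_normal_def normal_imp_subgroup)
    have sub': "subgroup (h ` K) H"
      by (rule subgroup_img_is_subgroup[OF sub])
    have eq: "preim (h ` K) = K"
      by (rule preim_image[OF sub K(2)])
    have "open_normal (h ` K) H S" "subgroup_index H (h ` K) \<le> enat n"
      using K open_normal_preim_iff[OF sub'] subgroup_index_preim[OF subgroup.subset[OF sub']]
      by (simp_all add: eq)
    then have "h x \<in> h ` K"
      using x subgroup.one_closed[OF sub'] by (auto simp: I_above_def preim_def)
    then show ?thesis
      using x by (subst eq[symmetric]) (simp add: preim_def)
  qed
  then show "x \<in> I_above G T (kernel G H h) n"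
    using x by (auto simp: I_above_def preim_def)
next
  fix x assume x: "x \<in> I_above G T (kernel G H h) n"
  have xG: "x \<in> carrier G"
    using x by (simp add: I_above_def)
  have "h x \<in> K" if K: "open_normal K H S" "subgroup_index H K \<le> enat n" for K
  proof -
    have sub: "subgroup K H"
      using K by (simp add: open_normal_def normal_imp_subgroup)
    have "x \<in> preim K"
      using x K open_normal_preim_iff[OF sub] kernel_subset_preim[OF sub]
        subgroup_index_preim[OF subgroup.subset[OF sub]] by (simp add: I_above_def)
    then show ?thesis
      by (simp add: preim_def)
  qed
  then show "x \<in> preim (I_above H S {\<one>\<^bsub>H\<^esub>} n)"
    using xG by (auto simp: I_above_def preim_def)
qed

lemma preim_Ob_above:
  assumes A: "subgroup A H"
  shows "preim (Ob_above s H S {\<one>\<^bsub>H\<^esub>} A) = Ob_above s G T (kernel G H h) (preim A)"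
proof -
  have act: "(if s then preim A else carrier G) \<subseteq> normalizer G (preim K) \<longleftrightarrow>
      (if s then A else carrier H) \<subseteq> normalizer H K" if "subgroup K H" for K
    using subset_normalizer_preim[OF A that] subset_normalizer_preim[OF cod.subgroup_self that]
    by (simp add: preim_carrier)
  show ?thesis
  proof (intro equalityI subsetI)
    fix x assume x: "x \<in> preim (Ob_above s H S {\<one>\<^bsub>H\<^esub>} A)"
    have xG: "x \<in> carrier G" "h x \<in> A"
      using x by (auto simp: preim_def Ob_above_def)
    have *: "x \<in> K" if K: "open_subgroup K G T" "kernel G H h \<subseteq> K"
      "(if s then preim A else carrier G) \<subseteq> normalizer G K" "\<not> K \<subseteq> preim A" for K
    proof -
      have sub: "subgroup K G"
        using K by (simp add: open_subgroup_def)
      have sub': "subgroup (h ` K) H"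
        by (rule subgroup_img_is_subgroup[OF sub])
      have eq: "preim (h ` K) = K"
        by (rule preim_image[OF sub K(2)])
      have "\<not> h ` K \<subseteq> A"
        using K(4) preim_subset_iff[OF subgroup.subset[OF sub'], of A] by (simp add: eq)
      moreover have "open_subgroup (h ` K) H S"
        by (rule open_subgroup_image[OF K(1,2)])
      moreover have "(if s then A else carrier H) \<subseteq> normalizer H (h ` K)"
        using act[OF sub'] K(3) by (simp only: eq simp_thms)
      ultimately have "h ` K \<in> {K. open_subgroup K H S \<and> {\<one>\<^bsub>H\<^esub>} \<subseteq> K \<and>
          (if s then A else carrier H) \<subseteq> normalizer H K \<and> \<not> K \<subseteq> A}"
        using subgroup.one_closed[OF sub'] by simp
      then have "h x \<in> h ` K"
        using x unfolding preim_def Ob_above_def by blast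
      then show ?thesis
        using xG by (subst eq[symmetric]) (simp add: preim_def)
    qed
    show "x \<in> Ob_above s G T (kernel G H h) (preim A)"
      unfolding Ob_above_def
    proof (intro IntI InterI)
      show "x \<in> preim A"
        using xG by (simp add: preim_def)
    qed (elim CollectE conjE, rule *)
  next
    fix x assume x: "x \<in> Ob_above s G T (kernel G H h) (preim A)"
    have xG: "x \<in> carrier G" "h x \<in> A"
      using x by (auto simp: preim_def Ob_above_def)
    have *: "h x \<in> K" if K: "open_subgroup K H S"
      "(if s then A else carrier H) \<subseteq> normalizer H K" "\<not> K \<subseteq> A" for K
    proof -
      have sub: "subgroup K H"
        using K by (simp add: open_subgroup_def)
      have "preim K \<in> {K. open_subgroup K G T \<and> kernel G H h \<subseteq> K \<and>
          (if s then preim A else carrier G) \<subseteq> normalizer G K \<and> \<not> K \<subseteq> preim A}"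
        using K act[OF sub] open_subgroup_preim kernel_subset_preim[OF sub]
          preim_subset_iff[OF subgroup.subset[OF sub], of A] by simp
      then have "x \<in> preim K"
        using x unfolding Ob_above_def by blast
      then show ?thesis
        by (simp add: preim_def)
    qed
    have "h x \<in> Ob_above s H S {\<one>\<^bsub>H\<^esub>} A"
      unfolding Ob_above_def
    proof (intro IntI InterI)
      show "h x \<in> A"
        using xG by simp
    qed (elim CollectE conjE, rule *)
    then show "x \<in> preim (Ob_above s H S {\<one>\<^bsub>H\<^esub>} A)"
      using xG by (simp add: preim_def)
  qed
qed

text \<open>The obliquity of an image is computed in \<open>G\<close> relative to the kernel.\<close>

lemma bounded_obliquity_image_iff:
  "bounded_obliquity s \<eta> H S \<longleftrightarrow>
     (\<forall>n\<ge>1. subgroup_index G (OI_above s G T (kernel G H h) n) \<le> enat (\<eta> n))"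
proof -
  have "subgroup_index H (OI_above s H S {\<one>\<^bsub>H\<^esub>} n) = subgroup_index G (OI_above s G T (kernel G H h) n)" for n
  proof -
    have "preim (OI_above s H S {\<one>\<^bsub>H\<^esub>} n) = OI_above s G T (kernel G H h) n"
      unfolding OI_above_def by (simp add: preim_Ob_above[OF cod.subgroup_I_above] preim_I_above)
    then show ?thesis
      using subgroup_index_preim[OF subgroup.subset[OF cod.subgroup_OI_above]] by metis
  qed
  then show ?thesis
    by (simp add: bounded_obliquity_def cod.profinite)
qed

end

context profinite
begin

lemma profinite_epi_quotient:
  assumes N: "closed_normal N G T"
  shows "profinite_epi G T (G Mod N) (quotient_topology G T N) (\<lambda>x. N #> x)"
proof -
  interpret normal N G
    using N by (simp add: closed_normal_def)
  show ?thesis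
    by (intro profinite_epi.intro profinite.intro profinite_axioms.intro profinite_epi_axioms.intro
        is_group profinite factorgroup_is_group profinite_quotient[OF N] r_coset_hom_Mod
        quotient_imp_continuous_map[OF quotient_map_coset] carrier_FactGroup[symmetric])
qed

lemma bounded_obliquity_quotient_iff:
  assumes N: "closed_normal N G T"
  shows "bounded_obliquity s \<eta> (G Mod N) (quotient_topology G T N) \<longleftrightarrow>
     (\<forall>n\<ge>1. subgroup_index G (OI_above s G T N n) \<le> enat (\<eta> n))"
proof -
  interpret normal N G
    using N by (simp add: closed_normal_def)
  interpret epi: profinite_epi G T "G Mod N" "quotient_topology G T N" "\<lambda>x. N #> x"
    by (rule profinite_epi_quotient[OF N])
  have "kernel G (G Mod N) (\<lambda>x. N #> x) = N"
    using coset_join1[of N] coset_join2[of _ N] subset subgroup_axioms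
    by (auto simp: kernel_def)
  then show ?thesis
    using epi.bounded_obliquity_image_iff by simp
qed

text \<open>Images of a group inherit the bound, since enlarging \<open>M\<close> enlarges the relative obliquity
  subgroups.\<close>

lemma every_image_bounded_obliquity_iff:
  "every_image (bounded_obliquity s \<eta>) G T \<longleftrightarrow> bounded_obliquity s \<eta> G T"
proof
  assume "every_image (bounded_obliquity s \<eta>) G T"
  then have "bounded_obliquity s \<eta> (G Mod {\<one>}) (quotient_topology G T {\<one>})"
    using closed_normal_one unfolding every_image_def by blast
  then show "bounded_obliquity s \<eta> G T"
    using bounded_obliquity_quotient_iff[OF closed_normal_one] profinite
    by (simp add: bounded_obliquity_def)
next
  assume b: "bounded_obliquity s \<eta> G T"
  show "every_image (bounded_obliquity s \<eta>) G T"
    unfolding every_image_def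
  proof (intro allI impI)
    fix N assume N: "closed_normal N G T"
    then have "\<one> \<in> N"
      by (simp add: closed_normal_def normal_imp_subgroup subgroup.one_closed)
    then have le: "subgroup_index G (OI_above s G T N n) \<le> subgroup_index G (OI_above s G T {\<one>} n)" for n
      by (intro subgroup_index_antimono subgroup_OI_above OI_above_mono) auto
    show "bounded_obliquity s \<eta> (G Mod N) (quotient_topology G T N)"
      using b order_trans[OF le] unfolding bounded_obliquity_quotient_iff[OF N]
      by (simp add: bounded_obliquity_def)
  qed
qed

end

section \<open>Inverse limits\<close>

context profinite
begin

lemma closedin_I_above: "closedin T (I_above G T M n)"
proof -
  have "I_above G T M n = \<Inter>(insert (carrier G) {K. open_normal K G T \<and> M \<subseteq> K \<and> subgroup_index G K \<le> enat n})"
    by (simp add: I_above_def)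
  also have "closedin T \<dots>"
    by (intro closedin_Inter)
      (auto intro: closedin_open_subgroup open_normal_imp_open_subgroup open_subgroup_carrier)
  finally show ?thesis .
qed

lemma subgroup_normalizer: "subgroup K G \<Longrightarrow> subgroup (normalizer G K) G"
  by (rule normalizer_imp_subgroup[OF subgroup.subset])

lemma subset_normalizer_self: "subgroup K G \<Longrightarrow> K \<subseteq> normalizer G K"
  by (simp add: subset_normalizer_iff subgroup.subset subgroup.m_closed subgroup.m_inv_closed)

lemma openin_normalizer:
  assumes "open_subgroup K G T" shows "openin T (normalizer G K)"
  using assms openin_supergroup[OF assms] subgroup_normalizer subset_normalizer_self
  by (simp add: open_subgroup_def)

text \<open>Each open subgroup that occurs in the definition of the right-hand side occurs, for some
  \<open>i\<close>, in the definition of the obliquity subgroup relative to \<open>M i\<close>, by compactness.\<close>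

lemma OI_above_directed_Inter:
  assumes ne: "I \<noteq> {}" and M: "\<And>i. i \<in> I \<Longrightarrow> closed_normal (M i) G T"
    and dir: "\<And>i j. i \<in> I \<Longrightarrow> j \<in> I \<Longrightarrow> \<exists>k\<in>I. M k \<subseteq> M i \<inter> M j"
    and Inter: "(\<Inter>i\<in>I. M i) = {\<one>}"
  shows "(\<Inter>i\<in>I. OI_above s G T (M i) n) \<subseteq> OI_above s G T {\<one>} n"
proof
  fix x assume x: "x \<in> (\<Inter>i\<in>I. OI_above s G T (M i) n)"
  let ?H = "\<lambda>i. I_above G T (M i) n" and ?L = "I_above G T {\<one>} n"
  have small: "\<exists>i\<in>I. M i \<subseteq> U" if "openin T U" "\<one> \<in> U" for U
  proof (rule compact_directed_Inter_subset[OF compact ne _ dir that(1)])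
    show "closedin T (M i)" if "i \<in> I" for i
      using M[OF that] by (simp add: closed_normal_def)
    show "(\<Inter>i\<in>I. M i) \<subseteq> U"
      using Inter that(2) by simp
  qed blast+
  have one: "\<one> \<in> K" if "subgroup K G" for K
    using that by (rule subgroup.one_closed)
  have Hmono: "?H k \<subseteq> ?H i" if "M k \<subseteq> M i" for i k
    using that by (rule I_above_mono)
  have Inter_H: "(\<Inter>i\<in>I. ?H i) \<subseteq> ?L"
  proof
    fix y assume y: "y \<in> (\<Inter>i\<in>I. ?H i)"
    have "y \<in> K" if K: "open_normal K G T" "subgroup_index G K \<le> enat n" for K
    proof -
      have "openin T K" "\<one> \<in> K"
        using K one by (auto simp: open_normal_def normal_imp_subgroup)
      then obtain i where "i \<in> I" "M i \<subseteq> K"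
        using small by blast
      moreover have "y \<in> ?H i"
        using y \<open>i \<in> I\<close> by blast
      ultimately show ?thesis
        using K by (simp add: I_above_def)
    qed
    moreover have "y \<in> carrier G"
    proof -
      obtain i where "y \<in> ?H i"
        using y ne by blast
      then show ?thesis
        by (simp add: I_above_def)
    qed
    ultimately show "y \<in> ?L"
      by (simp add: I_above_def)
  qed
  have xI: "x \<in> OI_above s G T (M i) n" if "i \<in> I" for i
    using x that by blast
  have *: "x \<in> K" if K: "open_subgroup K G T" "(if s then ?L else carrier G) \<subseteq> normalizer G K" "\<not> K \<subseteq> ?L" for K
  proof -
    have sub: "subgroup K G" and op: "openin T K"
      using K by (auto simp: open_subgroup_def)
    obtain a where a: "a \<in> I" "M a \<subseteq> K"
      using small[OF op one[OF sub]] by blast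
    obtain b where b: "b \<in> I" "\<not> K \<subseteq> ?H b"
      using K(3) Inter_H by blast
    obtain c where c: "c \<in> I" "(if s then ?H c else carrier G) \<subseteq> normalizer G K"
    proof (cases s)
      case True
      \<comment> \<open>the normaliser is open and contains the intersection of the closed sets \<open>?H i\<close>\<close>
      have dirH: "\<exists>k\<in>I. ?H k \<subseteq> ?H i \<inter> ?H j" if "i \<in> I" "j \<in> I" for i j
        using dir[OF that] Hmono by blast
      have HN: "(\<Inter>i\<in>I. ?H i) \<subseteq> normalizer G K"
        using K(2) True Inter_H by auto
      obtain c where "c \<in> I" "?H c \<subseteq> normalizer G K"
        by (rule compact_directed_Inter_subset[OF compact ne closedin_I_above dirH openin_normalizer[OF K(1)] HN])
      then show thesis
        using that True by simp
    next
      case False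
      then show thesis
        using that[OF a(1)] K(2) by simp
    qed
    obtain d where d: "d \<in> I" "M d \<subseteq> M a \<inter> M b"
      using dir[OF a(1) b(1)] by blast
    obtain k where k: "k \<in> I" "M k \<subseteq> M d \<inter> M c"
      using dir[OF d(1) c(1)] by blast
    have "M k \<subseteq> K" "\<not> K \<subseteq> ?H k"
      using k d a b Hmono[of k b] by blast+
    moreover have "(if s then ?H k else carrier G) \<subseteq> normalizer G K"
      using c(2) Hmono[of k c] k(2) by (auto split: if_splits)
    ultimately have "K \<in> {K. open_subgroup K G T \<and> M k \<subseteq> K \<and>
        (if s then ?H k else carrier G) \<subseteq> normalizer G K \<and> \<not> K \<subseteq> ?H k}"
      using K(1) by simp
    then show ?thesis
      using xI[OF k(1)] unfolding OI_above_def Ob_above_def by blast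
  qed
  show "x \<in> OI_above s G T {\<one>} n"
    unfolding OI_above_def Ob_above_def[of _ _ _ _ ?L]
  proof (intro IntI InterI)
    have "x \<in> ?H i" if "i \<in> I" for i
      using xI[OF that] by (simp add: OI_above_def Ob_above_def)
    then show "x \<in> ?L"
      using Inter_H by blast
  qed (elim CollectE conjE, rule *)
qed

lemma subgroup_index_directed_Inter:
  assumes ne: "I \<noteq> {}" and A: "\<And>i. i \<in> I \<Longrightarrow> subgroup (A i) G"
    and dir: "\<And>i j. i \<in> I \<Longrightarrow> j \<in> I \<Longrightarrow> \<exists>k\<in>I. A k \<subseteq> A i \<inter> A j"
    and le: "\<And>i. i \<in> I \<Longrightarrow> subgroup_index G (A i) \<le> enat c"
    and B: "subgroup B G" "(\<Inter>i\<in>I. A i) \<subseteq> B"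
  shows "subgroup_index G B \<le> enat c"
proof -
  have fin: "finite (rcosets (A i))" if "i \<in> I" for i
    using le[OF that] by (auto simp: subgroup_index_def split: if_splits)
  let ?f = "\<lambda>i. card (rcosets (A i))"
  have idx: "subgroup_index G (A i) = enat (?f i)" if "i \<in> I" for i
    using fin[OF that] by (simp add: subgroup_index_def)
  have "\<forall>i. i \<in> I \<longrightarrow> ?f i < Suc c"
    using le idx by (simp add: less_Suc_eq_le)
  moreover obtain i0 where "i0 \<in> I"
    using ne by blast
  \<comment> \<open>a member of largest index lies in all the others\<close>
  ultimately obtain m where m: "m \<in> I" "\<And>i. i \<in> I \<Longrightarrow> ?f i \<le> ?f m"
    using ex_has_greatest_nat[of "\<lambda>i. i \<in> I" i0 ?f "Suc c"] by blast
  have Am: "A m \<subseteq> A i" if i: "i \<in> I" for i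
  proof -
    obtain k where k: "k \<in> I" "A k \<subseteq> A i \<inter> A m"
      using dir[OF i m(1)] by blast
    then have "A k = A m"
      using m(2)[OF k(1)] idx[OF k(1)] idx[OF m(1)] fin[OF k(1)] A[OF k(1)] A[OF m(1)]
      by (intro subgroup_eq_of_index_le) auto
    then show ?thesis
      using k by blast
  qed
  have "A m \<subseteq> B"
    by (rule order_trans[OF INT_greatest[OF Am] B(2)])
  then show ?thesis
    using order_trans[OF subgroup_index_antimono[OF A[OF m(1)] B(1)] le[OF m(1)]] by simp
qed

lemma bounded_obliquity_directed:
  assumes ne: "I \<noteq> {}" and M: "\<And>i. i \<in> I \<Longrightarrow> closed_normal (M i) G T"
    and dir: "\<And>i j. i \<in> I \<Longrightarrow> j \<in> I \<Longrightarrow> \<exists>k\<in>I. M k \<subseteq> M i \<inter> M j"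
    and Inter: "(\<Inter>i\<in>I. M i) = {\<one>}"
    and le: "\<And>i n. i \<in> I \<Longrightarrow> n \<ge> 1 \<Longrightarrow> subgroup_index G (OI_above s G T (M i) n) \<le> enat (\<eta> n)"
  shows "bounded_obliquity s \<eta> G T"
  unfolding bounded_obliquity_def
proof (intro conjI allI impI profinite)
  fix n :: nat assume n: "n \<ge> 1"
  show "subgroup_index G (OI_above s G T {\<one>} n) \<le> enat (\<eta> n)"
  proof (rule subgroup_index_directed_Inter[OF ne])
    show "\<exists>k\<in>I. OI_above s G T (M k) n \<subseteq> OI_above s G T (M i) n \<inter> OI_above s G T (M j) n"
      if ij: "i \<in> I" "j \<in> I" for i j
    proof -
      obtain k where "k \<in> I" "M k \<subseteq> M i" "M k \<subseteq> M j"
        using dir[OF ij] by blast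
      then show ?thesis
        using OI_above_mono by (intro bexI[of _ k]) blast+
    qed
    show "(\<Inter>i\<in>I. OI_above s G T (M i) n) \<subseteq> OI_above s G T {\<one>} n"
      by (rule OI_above_directed_Inter[OF ne M dir Inter])
  qed (use le n subgroup_OI_above in auto)
qed

text \<open>The isomorphism with the inverse limit need not be compatible with the natural projections,
  so the directed family used here consists of the kernels of the composite maps from \<open>G\<close> through
  the limit onto \<open>G / N i\<close>, not of the subgroups \<open>N i\<close>, whose intersection may be non-trivial.\<close>

lemma bounded_obliquity_inverse_limit:
  assumes lim: "inverse_limit_of_images (bounded_obliquity s \<eta>) G T I r N"
  shows "bounded_obliquity s \<eta> G T"
proof -
  let ?f = "\<lambda>i j. natural_quotient_map G (N i) (N j)"
  let ?Q = "\<lambda>i. G Mod N i" and ?S = "\<lambda>i. quotient_topology G T (N i)"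
  have I: "I \<noteq> {}" and dirI: "\<And>i j. i \<in> I \<Longrightarrow> j \<in> I \<Longrightarrow> \<exists>k\<in>I. (i, k) \<in> r \<and> (j, k) \<in> r"
    using lim by (auto simp: inverse_limit_of_images_def directed_set_def)
  have N: "closed_normal (N i) G T" if "i \<in> I" for i
    using lim that by (simp add: inverse_limit_of_images_def)
  have Nmono: "N i \<subseteq> N j" if "i \<in> I" "j \<in> I" "(j, i) \<in> r" for i j
    using lim that by (simp add: inverse_limit_of_images_def)
  have b: "bounded_obliquity s \<eta> (?Q i) (?S i)" if "i \<in> I" for i
    using lim that by (simp add: inverse_limit_of_images_def)
  obtain \<phi> where iso: "\<phi> \<in> iso G (invlim_group I r ?Q ?f)"
    and homeo: "homeomorphic_map T (invlim_topology I r ?Q ?S ?f) \<phi>"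
    using lim by (auto simp: inverse_limit_of_images_def topological_group_iso_def)
  have nor: "N i \<lhd> G" if "i \<in> I" for i
    using N[OF that] by (simp add: closed_normal_def)
  have grp: "group (?Q i)" if "i \<in> I" for i
    using normal.factorgroup_is_group[OF nor[OF that]] .
  have carr: "\<phi> ` carrier G = invlim_carrier I r ?Q ?f" and inj: "inj_on \<phi> (carrier G)"
    using iso by (auto simp: iso_def bij_betw_def invlim_group_def)
  have \<phi>_mem: "\<phi> x \<in> invlim_carrier I r ?Q ?f" if "x \<in> carrier G" for x
    using carr that by blast
  have \<phi>_comp: "\<phi> x i \<in> carrier (?Q i)" if "x \<in> carrier G" "i \<in> I" for x i
    using \<phi>_mem[OF that(1)] that(2) by (auto simp: invlim_carrier_def carrier_product_group)
  have \<phi>_mult: "\<phi> (x \<otimes> y) i = \<phi> x i \<otimes>\<^bsub>?Q i\<^esub> \<phi> y i" if "x \<in> carrier G" "y \<in> carrier G" "i \<in> I" for x y i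
    using iso that by (simp add: iso_def hom_def invlim_group_def product_group_def)
  have \<phi>_compat: "?f i j (\<phi> x i) = \<phi> x j" if "x \<in> carrier G" "i \<in> I" "j \<in> I" "(j, i) \<in> r" for x i j
    using \<phi>_mem[OF that(1)] that by (simp add: invlim_carrier_def)
  have epi: "profinite_epi G T (?Q i) (?S i) (\<lambda>x. \<phi> x i)" if i: "i \<in> I" for i
  proof -
    have "(\<lambda>x. \<phi> x i) \<in> hom G (?Q i)"
      using \<phi>_comp \<phi>_mult i by (simp add: hom_def)
    moreover have "continuous_map T (?S i) (\<lambda>x. \<phi> x i)"
    proof -
      have "continuous_map T (product_topology ?S I) \<phi>"
        using homeomorphic_imp_continuous_map[OF homeo]
        by (simp add: invlim_topology_def continuous_map_in_subtopology)
      from continuous_map_compose[OF this continuous_map_product_projection[OF i]]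
      show ?thesis
        by (simp add: o_def)
    qed
    moreover have "(\<lambda>x. \<phi> x i) ` carrier G = carrier (?Q i)"
    proof
      show "carrier (?Q i) \<subseteq> (\<lambda>x. \<phi> x i) ` carrier G"
      proof
        fix c assume "c \<in> carrier (?Q i)"
        then obtain g where g: "g \<in> carrier G" "c = N i #> g"
          by (auto simp: carrier_FactGroup)
        \<comment> \<open>the cosets of \<open>g\<close> form a thread of the inverse system\<close>
        have "(\<lambda>j\<in>I. N j #> g) \<in> invlim_carrier I r ?Q ?f"
          using g nor Nmono natural_quotient_map_coset[OF is_group]
          by (auto simp: invlim_carrier_def carrier_product_group carrier_FactGroup)
        then obtain x where "x \<in> carrier G" "\<phi> x = (\<lambda>j\<in>I. N j #> g)"
          using carr by (metis imageE)
        then show "c \<in> (\<lambda>x. \<phi> x i) ` carrier G"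
          using g i by (intro image_eqI[of _ _ x]) auto
      qed
    qed (use \<phi>_comp i in auto)
    ultimately show ?thesis
      by (intro profinite_epi.intro profinite.intro profinite_axioms.intro profinite_epi_axioms.intro
        is_group profinite grp profinite_quotient N i)
  qed
  define M where "M i = kernel G (?Q i) (\<lambda>x. \<phi> x i)" for i
  have M_iff: "x \<in> M i \<longleftrightarrow> x \<in> carrier G \<and> \<phi> x i = N i" for x i
    by (simp add: M_def kernel_def)
  have M_closed_normal: "closed_normal (M i) G T" if i: "i \<in> I" for i
  proof -
    interpret epi: profinite_epi G T "?Q i" "?S i" "\<lambda>x. \<phi> x i"
      by (rule epi[OF i])
    have "closedin T {x \<in> topspace T. \<phi> x i \<in> {\<one>\<^bsub>?Q i\<^esub>}}"
      using epi.cod.closed_normal_one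
      by (intro closedin_continuous_map_preimage[OF epi.cont]) (simp add: closed_normal_def)
    moreover have "{x \<in> topspace T. \<phi> x i \<in> {\<one>\<^bsub>?Q i\<^esub>}} = M i"
      by (auto simp: M_iff topspace_eq)
    ultimately show ?thesis
      using epi.normal_kernel by (simp add: closed_normal_def M_def)
  qed
  have M_mono: "M i \<subseteq> M j" if ij: "i \<in> I" "j \<in> I" "(j, i) \<in> r" for i j
  proof
    fix x assume x: "x \<in> M i"
    then have "\<phi> x j = ?f i j (N i #> \<one>)"
      using \<phi>_compat[of x i j] ij M_iff nor[OF ij(1)] by (simp add: normal_imp_subgroup subgroup.subset)
    also have "\<dots> = N j"
      using natural_quotient_map_coset[OF is_group nor[OF ij(1)] nor[OF ij(2)] Nmono[OF ij] one_closed]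
        nor[OF ij(2)] by (simp add: normal_imp_subgroup subgroup.subset)
    finally show "x \<in> M j"
      using x by (simp add: M_iff)
  qed
  have "(\<Inter>i\<in>I. M i) = {\<one>}"
  proof
    show "(\<Inter>i\<in>I. M i) \<subseteq> {\<one>}"
    proof
      fix x assume x: "x \<in> (\<Inter>i\<in>I. M i)"
      have xG: "x \<in> carrier G"
        using x I by (auto simp: M_iff)
      have "\<one> \<in> M i" if "i \<in> I" for i
        using M_closed_normal[OF that] by (simp add: closed_normal_def normal_imp_subgroup subgroup.one_closed)
      then have "\<phi> x i = \<phi> \<one> i" if "i \<in> I" for i
        using x that by (simp add: M_iff)
      moreover have "\<phi> x \<in> extensional I" "\<phi> \<one> \<in> extensional I"
        using \<phi>_mem[OF xG] \<phi>_mem[OF one_closed]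
        by (auto simp: invlim_carrier_def carrier_product_group PiE_def)
      ultimately have "\<phi> x = \<phi> \<one>"
        by (intro extensionalityI)
      then show "x \<in> {\<one>}"
        using inj_onD[OF inj _ xG one_closed] by simp
    qed
    show "{\<one>} \<subseteq> (\<Inter>i\<in>I. M i)"
      using M_closed_normal by (auto simp: closed_normal_def normal_imp_subgroup subgroup.one_closed)
  qed
  then show ?thesis
  proof (rule bounded_obliquity_directed[OF I M_closed_normal, rotated -2])
    show "\<exists>k\<in>I. M k \<subseteq> M i \<inter> M j" if "i \<in> I" "j \<in> I" for i j
      using dirI[OF that] M_mono that by blast
    show "subgroup_index G (OI_above s G T (M i) n) \<le> enat (\<eta> n)" if "i \<in> I" "n \<ge> 1" for i n
      using b[OF that(1)] that(2) unfolding profinite_epi.bounded_obliquity_image_iff[OF epi[OF that(1)]]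
      by (simp add: M_def)
  qed
qed

text \<open>Conversely, \<open>G\<close> is the inverse limit of the single group \<open>G / {\<one>}\<close>.\<close>

lemma inverse_limit_singleton:
  assumes "every_image (bounded_obliquity s \<eta>) G T"
  shows "inverse_limit_of_images (bounded_obliquity s \<eta>) G T {i} {(i, i)} (\<lambda>_. {\<one>})"
proof -
  let ?Q = "\<lambda>_. G Mod {\<one>}" and ?S = "\<lambda>_. quotient_topology G T {\<one>}"
    and ?f = "\<lambda>_ _. natural_quotient_map G {\<one>} {\<one>}"
  let ?L = "invlim_carrier {i} {(i, i)} ?Q ?f"
  define \<phi> where "\<phi> x = (\<lambda>j\<in>{i}. {\<one>} #> x)" for x
  have coset: "{\<one>} #> x = {x}" if "x \<in> carrier G" for x
    using that by (simp add: r_coset_def)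
  have nat_id: "natural_quotient_map G {\<one>} {\<one>} {x} = {x}" if "x \<in> carrier G" for x
    using natural_quotient_map_coset[OF is_group one_is_normal one_is_normal _ that] coset[OF that] by simp
  have QC: "carrier (G Mod {\<one>}) = (\<lambda>x. {x}) ` carrier G"
    using coset by (simp add: carrier_FactGroup)
  have L: "?L = \<phi> ` carrier G"
  proof (intro equalityI subsetI)
    fix y assume y: "y \<in> ?L"
    then have "y i \<in> carrier (G Mod {\<one>})"
      by (auto simp: invlim_carrier_def carrier_product_group)
    then obtain x where x: "x \<in> carrier G" "y i = {x}"
      by (auto simp: QC)
    moreover have "y \<in> extensional {i}"
      using y by (auto simp: invlim_carrier_def carrier_product_group PiE_def)
    ultimately have "y = \<phi> x"
      by (intro extensionalityI[of y "{i}"]) (auto simp: \<phi>_def coset)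
    then show "y \<in> \<phi> ` carrier G"
      using x by blast
  next
    fix y assume "y \<in> \<phi> ` carrier G"
    then show "y \<in> ?L"
      by (auto simp: \<phi>_def coset nat_id invlim_carrier_def carrier_product_group QC)
  qed
  have inj: "inj_on \<phi> (carrier G)"
    by (rule inj_onI) (auto simp: \<phi>_def coset dest: fun_cong[of _ _ i])
  have "\<phi> \<in> iso G (invlim_group {i} {(i, i)} ?Q ?f)"
    unfolding iso_def
  proof (intro CollectI conjI)
    show "\<phi> \<in> hom G (invlim_group {i} {(i, i)} ?Q ?f)"
      using L by (auto simp: hom_def invlim_group_def product_group_def \<phi>_def coset set_mult_def fun_eq_iff)
    show "bij_betw \<phi> (carrier G) (carrier (invlim_group {i} {(i, i)} ?Q ?f))"
      using inj L by (simp add: bij_betw_def invlim_group_def)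
  qed
  moreover have "homeomorphic_map T (invlim_topology {i} {(i, i)} ?Q ?S ?f) \<phi>"
  proof -
    have "continuous_map T (product_topology ?S {i}) \<phi>"
      unfolding continuous_map_componentwise
      using quotient_imp_continuous_map[OF quotient_map_coset] by (auto simp: \<phi>_def)
    then have cont: "continuous_map T (invlim_topology {i} {(i, i)} ?Q ?S ?f) \<phi>"
      using L by (auto simp: invlim_topology_def continuous_map_in_subtopology topspace_eq)
    have "Hausdorff_space (quotient_topology G T {\<one>})"
      using profinite_quotient[OF closed_normal_one] by (simp add: profinite_group_def)
    then have "Hausdorff_space (invlim_topology {i} {(i, i)} ?Q ?S ?f)"
      unfolding invlim_topology_def by (intro Hausdorff_space_subtopology) (simp add: Hausdorff_space_product_topology)
    moreover have "topspace (invlim_topology {i} {(i, i)} ?Q ?S ?f) = ?L"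
      using topspace_quotient_topology[OF topspace_eq, of "{\<one>}"]
      by (auto simp: invlim_topology_def invlim_carrier_def carrier_product_group)
    ultimately show ?thesis
      using inj L by (intro continuous_imp_homeomorphic_map[OF cont compact]) (simp_all add: topspace_eq)
  qed
  ultimately have "topological_group_iso G T (invlim_group {i} {(i, i)} ?Q ?f)
      (invlim_topology {i} {(i, i)} ?Q ?S ?f)"
    unfolding topological_group_iso_def by blast
  moreover have "directed_set {i} {(i, i)}"
    by (auto simp: directed_set_def preorder_on_def refl_on_def trans_def)
  ultimately show ?thesis
    using assms closed_normal_one by (simp add: inverse_limit_of_images_def every_image_def)
qed

lemma bounded_obliquity_iff_inverse_limit:
  "bounded_obliquity s \<eta> G T \<longleftrightarrow>
     (\<exists>(I :: 'i set) r N. inverse_limit_of_images (bounded_obliquity s \<eta>) G T I r N)"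
  using bounded_obliquity_inverse_limit inverse_limit_singleton
  unfolding every_image_bounded_obliquity_iff by metis

end

section \<open>Just infinite groups\<close>

context profinite
begin

lemma finite_rcosets_iff_openin:
  assumes "closed_normal N G T"
  shows "finite (rcosets N) \<longleftrightarrow> openin T N"
  using assms openin_closed_subgroup_finite_index[of N] finite_rcosets_open_subgroup[of N]
  by (auto simp: closed_normal_def open_subgroup_def normal_imp_subgroup)

lemma just_infinite_iff:
  "just_infinite G T \<longleftrightarrow> infinite (carrier G) \<and>
     (\<forall>N. closed_normal N G T \<and> N \<noteq> {\<one>} \<longrightarrow> openin T N)"
proof -
  have "(closed_normal N G T \<and> N \<noteq> {\<one>} \<longrightarrow> subgroup_index G N < \<infinity>) \<longleftrightarrow>
      (closed_normal N G T \<and> N \<noteq> {\<one>} \<longrightarrow> openin T N)" for N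
    unfolding subgroup_index_finite_iff using finite_rcosets_iff_openin[of N] by blast
  then show ?thesis
    unfolding just_infinite_def using profinite by simp
qed

lemma open_normal_carrier: "open_normal (carrier G) G T"
  using open_subgroup_carrier normal_iff_subset_normalizer[of "carrier G"]
    subset_normalizer_self[OF subgroup_self]
  by (simp add: open_normal_def open_subgroup_def)

lemma open_normal_imp_closed_normal: "open_normal K G T \<Longrightarrow> closed_normal K G T"
  using closedin_open_subgroup[OF open_normal_imp_open_subgroup] by (auto simp: open_normal_def closed_normal_def)

lemma closed_normal_INT:
  assumes "\<And>n::nat. open_normal (D n) G T" shows "closed_normal (\<Inter>n. D n) G T"
  unfolding closed_normal_def
proof
  have D: "D n \<lhd> G" "closedin T (D n)" for n
    using open_normal_imp_closed_normal[OF assms] by (auto simp: closed_normal_def)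
  show "closedin T (\<Inter>n. D n)"
    using D by blast
  show "(\<Inter>n. D n) \<lhd> G"
  proof (rule normal_invI)
    show "subgroup (\<Inter>n. D n) G"
      using D by (intro subgroups_Inter) (auto simp: normal_imp_subgroup)
    show "x \<otimes> k \<otimes> inv x \<in> (\<Inter>n. D n)" if "x \<in> carrier G" "k \<in> (\<Inter>n. D n)" for x k
      using that normal_invE(2)[OF D(1)] by auto
  qed
qed

text \<open>A non-trivial intersection would be open, with only finitely many subgroups above it.\<close>

lemma just_infinite_descending_Inter:
  assumes ji: "just_infinite G T" and D: "\<And>n::nat. open_normal (D n) G T"
    and dec: "\<And>n. D (Suc n) \<subset> D n"
  shows "(\<Inter>n. D n) = {\<one>}"
proof (rule ccontr)
  assume "(\<Inter>n. D n) \<noteq> {\<one>}"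
  then have "open_subgroup (\<Inter>n. D n) G T"
    using ji closed_normal_INT[of D, OF D]
    by (auto simp: just_infinite_iff open_subgroup_def closed_normal_def normal_imp_subgroup)
  then have "finite {K. subgroup K G \<and> (\<Inter>n. D n) \<subseteq> K}"
    using finite_subgroups_above[OF _ finite_rcosets_open_subgroup] by (auto simp: open_subgroup_def)
  moreover have "range D \<subseteq> {K. subgroup K G \<and> (\<Inter>n. D n) \<subseteq> K}"
    using D by (auto simp: open_normal_def normal_imp_subgroup)
  ultimately have "finite (range D)"
    by (rule finite_subset[rotated])
  moreover have "inj D"
  proof (rule injI)
    fix m n assume eq: "D m = D n"
    have less: "D n \<subset> D m" if "m < n" for m n
      using that by (rule lift_Suc_mono_less[of "\<lambda>n. - D n", simplified, rotated]) (use dec in auto)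
    show "m = n"
      using less[of m n] less[of n m] eq by (cases m n rule: linorder_cases) auto
  qed
  ultimately show False
    using finite_imageD by blast
qed

lemma descending_Inter_meets:
  assumes D: "\<And>n::nat. closedin T (D n)" and dec: "\<And>n. D (Suc n) \<subseteq> D n"
    and C: "closedin T C" and ne: "\<And>n. D n \<inter> C \<noteq> {}"
  shows "(\<Inter>n. D n) \<inter> C \<noteq> {}"
proof -
  have "(\<Inter>n. D n \<inter> C) \<noteq> {}"
  proof (rule compact_space_imp_nest[OF compact])
    show "decseq (\<lambda>n. D n \<inter> C)"
      using dec by (intro decseq_SucI) blast
  qed (use D C ne in auto)
  then show ?thesis
    by auto
qed

text \<open>The key finiteness result. Suppose that infinitely many open normal subgroups are not
  contained in the open neighbourhood \<open>U\<close> of \<open>\<one>\<close>. There is no infinite strictly descending chain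
  of such subgroups: its intersection would be trivial, but by compactness it is not contained in
  \<open>U\<close>. So there is a minimal \<open>L\<close> among those that contain infinitely many others. Given an open
  normal \<open>E \<subseteq> L\<close>, only finitely many of the subgroups \<open>K \<subseteq> L\<close> satisfy \<open>K E \<noteq> L\<close>, since there are
  finitely many possibilities for \<open>K E\<close> and \<open>L\<close> is minimal. This gives a strictly descending
  sequence \<open>D n\<close> with \<open>D n K1 = L\<close> for a fixed \<open>K1 \<subset> L\<close>. Its intersection is trivial, so that
  compactness gives \<open>K1 = L\<close>, a contradiction.\<close>

lemma just_infinite_finite_not_subset:
  assumes ji: "just_infinite G T" and U: "openin T U" and one: "\<one> \<in> U"
  shows "finite {K. open_normal K G T \<and> \<not> K \<subseteq> U}"
proof -
  let ?K = "{K. open_normal K G T \<and> \<not> K \<subseteq> U}"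
  have wf: "wf {(A, B). A \<in> ?K \<and> B \<in> ?K \<and> A \<subset> B}"
    unfolding wf_iff_no_infinite_down_chain
  proof
    assume "\<exists>f. \<forall>i::nat. (f (Suc i), f i) \<in> {(A, B). A \<in> ?K \<and> B \<in> ?K \<and> A \<subset> B}"
    then obtain D :: "nat \<Rightarrow> 'a set"
      where "\<forall>n. (D (Suc n), D n) \<in> {(A, B). A \<in> ?K \<and> B \<in> ?K \<and> A \<subset> B}"
      by blast
    then have D: "\<And>n. open_normal (D n) G T" "\<And>n. \<not> D n \<subseteq> U" "\<And>n. D (Suc n) \<subset> D n"
      by auto
    have "(\<Inter>n. D n) \<inter> (carrier G - U) \<noteq> {}"
    proof (rule descending_Inter_meets)
      show "closedin T (D n)" for n
        using open_normal_imp_closed_normal[OF D(1)] by (simp add: closed_normal_def)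
      show "closedin T (carrier G - U)"
        using U topspace_eq by (metis closedin_diff closedin_topspace)
      show "D n \<inter> (carrier G - U) \<noteq> {}" for n
        using D(1,2)[of n] openin_subset[of T "D n"] topspace_eq by (auto simp: open_normal_def)
    qed (use D in blast)
    then show False
      using just_infinite_descending_Inter[of D, OF ji D(1,3)] one by auto
  qed
  show ?thesis
  proof (rule ccontr)
    assume inf: "infinite ?K"
    define bad where "bad L \<longleftrightarrow> L \<in> ?K \<and> infinite {K \<in> ?K. K \<subseteq> L}" for L
    have "carrier G \<in> ?K"
    proof -
      obtain K where "K \<in> ?K"
        using infinite_imp_nonempty[OF inf] by blast
      then have "\<not> carrier G \<subseteq> U"
        using openin_subset[of T K] topspace_eq by (auto simp: open_normal_def)
      then show ?thesis
        by (simp add: open_normal_carrier)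
    qed
    moreover have "{K \<in> ?K. K \<subseteq> carrier G} = ?K"
      using openin_subset topspace_eq by (fastforce simp: open_normal_def)
    ultimately have badG: "carrier G \<in> Collect bad"
      using inf by (simp add: bad_def)
    obtain L where L: "bad L" and min: "\<And>A. (A, L) \<in> {(A, B). A \<in> ?K \<and> B \<in> ?K \<and> A \<subset> B} \<Longrightarrow> \<not> bad A"
    proof (rule wfE_min[OF wf badG])
      fix L assume "L \<in> Collect bad"
        "\<And>A. (A, L) \<in> {(A, B). A \<in> ?K \<and> B \<in> ?K \<and> A \<subset> B} \<Longrightarrow> A \<notin> Collect bad"
      then show thesis
        by (intro that[of L]) simp_all
    qed
    have LK: "open_normal L G T" "infinite {K \<in> ?K. K \<subseteq> L}" "L \<in> ?K"
      using L by (auto simp: bad_def)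
    have Lsub: "subgroup L G"
      using LK(1) by (simp add: open_normal_def normal_imp_subgroup)
    \<comment> \<open>every open normal \<open>E \<le> L\<close> has a supplement in \<open>L\<close> among the subgroups considered\<close>
    have supp: "\<exists>K. K \<in> ?K \<and> K \<subset> L \<and> K <#> E = L" if E: "open_normal E G T" "E \<subseteq> L" for E
    proof (rule ccontr)
      assume no: "\<not> ?thesis"
      have Esub: "subgroup E G" "E \<lhd> G"
        using E by (auto simp: open_normal_def normal_imp_subgroup)
      let ?B = "{B. subgroup B G \<and> E \<subseteq> B}"
      have fin: "finite ?B"
        using finite_subgroups_above[OF Esub(1) finite_rcosets_open_subgroup[OF open_normal_imp_open_subgroup[OF E(1)]]] .
      have sub: "{K \<in> ?K. K \<subset> L} \<subseteq> (\<Union>B\<in>{B \<in> ?B. open_normal B G T \<and> B \<subset> L}. {K \<in> ?K. K \<subseteq> B})"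
      proof
        fix K assume K: "K \<in> {K \<in> ?K. K \<subset> L}"
        then have Ksub: "subgroup K G" "K \<lhd> G" "open_subgroup K G T"
          by (auto simp: open_normal_def open_subgroup_def normal_imp_subgroup)
        have nor: "K <#> E \<lhd> G"
          using Ksub Esub by (intro normal_subgroup_set_mult_closed)
        have KE: "K \<subseteq> K <#> E" "E \<subseteq> K <#> E"
          using subgroup.one_closed[OF Ksub(1)] subgroup.one_closed[OF Esub(1)]
            subgroup.mem_carrier[OF Ksub(1)] subgroup.mem_carrier[OF Esub(1)]
          by (force simp: set_mult_def)+
        have op: "open_normal (K <#> E) G T"
          using openin_supergroup[OF Ksub(3) normal_imp_subgroup[OF nor] KE(1)] nor
          by (simp add: open_normal_def)
        have "K <#> E \<subseteq> L"
          using K E subgroup.m_closed[OF Lsub] by (auto simp: set_mult_def)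
        moreover have "K <#> E \<noteq> L"
          using no K by blast
        ultimately show "K \<in> (\<Union>B\<in>{B \<in> ?B. open_normal B G T \<and> B \<subset> L}. {K \<in> ?K. K \<subseteq> B})"
          using K KE op normal_imp_subgroup[OF nor] by (intro UN_I[of "K <#> E"]) auto
      qed
      have finB: "finite {K \<in> ?K. K \<subseteq> B}" if B: "open_normal B G T" "B \<subset> L" for B
      proof (cases "B \<subseteq> U")
        case True
        then have "{K \<in> ?K. K \<subseteq> B} = {}"
          by blast
        then show ?thesis
          by (simp only: finite.emptyI)
      next
        case False
        then show ?thesis
          using min[of B] B LK(3) unfolding bad_def by simp
      qed
      have "finite {K \<in> ?K. K \<subset> L}"
      proof (rule finite_subset[OF sub finite_UN_I])
        show "finite {B \<in> ?B. open_normal B G T \<and> B \<subset> L}"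
          by (rule finite_subset[OF _ fin]) auto
      qed (use finB in simp)
      moreover have "{K \<in> ?K. K \<subseteq> L} \<subseteq> insert L {K \<in> ?K. K \<subset> L}"
        by blast
      ultimately show False
        using LK(2) finite_subset[of "{K \<in> ?K. K \<subseteq> L}" "insert L {K \<in> ?K. K \<subset> L}"] by simp
    qed
    obtain K1 where K1: "K1 \<in> ?K" "K1 \<subset> L"
      using supp[OF LK(1)] by blast
    have K1on: "open_normal K1 G T"
      using K1 by simp
    have K1sub: "subgroup K1 G"
      using K1on by (simp add: open_normal_def normal_imp_subgroup)
    let ?P = "\<lambda>D. open_normal D G T \<and> D \<subseteq> L \<and> L \<subseteq> D <#> K1"
    \<comment> \<open>with \<open>K (D \<inter> K1) = L\<close>, the modular law gives \<open>D = (D \<inter> K) (D \<inter> K1)\<close>, so \<open>D \<inter> K\<close> can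
      replace \<open>D\<close>\<close>
    have step: "\<exists>D'. ?P D' \<and> D' \<subset> D" if D: "?P D" for D
    proof -
      have DK: "open_normal (D \<inter> K1) G T" "D \<inter> K1 \<subseteq> L"
        using D K1on K1 open_normal_Int by auto
      obtain K where K: "K \<in> ?K" "K \<subset> L" "K <#> (D \<inter> K1) = L"
        using supp[OF DK] by blast
      have Dsub: "subgroup D G" and Ksub: "subgroup K G"
        using D K by (auto simp: open_normal_def normal_imp_subgroup)
      have "\<not> D \<subseteq> K"
      proof
        assume "D \<subseteq> K"
        then have "K <#> (D \<inter> K1) \<subseteq> K"
          using subgroup.m_closed[OF Ksub] by (auto simp: set_mult_def)
        then show False
          using K by blast
      qed
      moreover have "L \<subseteq> (D \<inter> K) <#> K1"
      proof
        fix x assume "x \<in> L"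
        then obtain d k where dk: "d \<in> D" "k \<in> K1" "x = d \<otimes> k"
          using D by (auto simp: set_mult_def)
        then obtain a b where ab: "a \<in> K" "b \<in> D" "b \<in> K1" "d = a \<otimes> b"
          using D K(3) by (auto simp: set_mult_def)
        have car: "a \<in> carrier G" "b \<in> carrier G" "k \<in> carrier G"
          using ab dk subgroup.mem_carrier[OF Ksub] subgroup.mem_carrier[OF K1sub] by auto
        have "d \<otimes> inv b \<in> D"
          using ab dk subgroup.m_closed[OF Dsub] subgroup.m_inv_closed[OF Dsub] by simp
        then have "a \<in> D"
          using ab car by (simp add: m_assoc)
        moreover have "x = a \<otimes> (b \<otimes> k)"
          using ab dk car by (simp add: m_assoc)
        moreover have "b \<otimes> k \<in> K1"
          using ab dk subgroup.m_closed[OF K1sub] by simp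
        ultimately show "x \<in> (D \<inter> K) <#> K1"
          using ab(1) unfolding set_mult_def by blast
      qed
      moreover have "open_normal (D \<inter> K) G T"
        using D K open_normal_Int by simp
      ultimately show ?thesis
        using D by (intro exI[of _ "D \<inter> K"]) blast
    qed
    have "L \<subseteq> L <#> K1"
      using subgroup.mem_carrier[OF Lsub] subgroup.one_closed[OF K1sub] by (force simp: set_mult_def)
    then have base: "?P L"
      using LK(1) by simp
    have "\<exists>D. \<forall>n::nat. ?P (D n) \<and> D (Suc n) \<subset> D n"
      by (rule dependent_nat_choice) (use base step in blast)+
    then obtain D :: "nat \<Rightarrow> 'a set" where "\<forall>n. ?P (D n) \<and> D (Suc n) \<subset> D n" ..
    then have D: "\<And>n. ?P (D n)" "\<And>n. D (Suc n) \<subset> D n"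
      by simp_all
    have Don: "open_normal (D n) G T" for n
      using D(1) by blast
    have Inter: "(\<Inter>n. D n) = {\<one>}"
      by (rule just_infinite_descending_Inter[of D, OF ji Don D(2)])
    have "L \<subseteq> K1"
    proof
      fix x assume x: "x \<in> L"
      then have xG: "x \<in> carrier G"
        by (rule subgroup.mem_carrier[OF Lsub])
      have "(\<Inter>n. D n) \<inter> (K1 #> x) \<noteq> {}"
      proof (rule descending_Inter_meets)
        show "closedin T (D n)" for n
          using open_normal_imp_closed_normal[OF Don] by (simp add: closed_normal_def)
        show "closedin T (K1 #> x)"
          by (rule closedin_r_coset[OF closedin_open_subgroup[OF open_normal_imp_open_subgroup[OF K1on]] xG])
        show "D n \<inter> (K1 #> x) \<noteq> {}" for n
        proof -
          have "inv x \<in> L"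
            using x subgroup.m_inv_closed[OF Lsub] by simp
          then obtain d k where dk: "d \<in> D n" "k \<in> K1" "inv x = d \<otimes> k"
            using D(1)[of n] by (auto simp: set_mult_def)
          have Dsub: "subgroup (D n) G"
            using Don by (simp add: open_normal_def normal_imp_subgroup)
          have car: "d \<in> carrier G" "k \<in> carrier G"
            using dk subgroup.mem_carrier[OF Dsub] subgroup.mem_carrier[OF K1sub] by auto
          have "x = inv k \<otimes> inv d"
            using dk car xG by (metis inv_inv inv_mult_group)
          then have "inv d = k \<otimes> x"
            using car by (simp add: m_assoc[symmetric])
          then have "inv d \<in> K1 #> x"
            using dk by (auto simp: r_coset_def)
          moreover have "inv d \<in> D n"
            using dk subgroup.m_inv_closed[OF Dsub] by simp
          ultimately show ?thesis
            by blast
        qed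
      qed (use D(2) in blast)
      then have "\<one> \<in> K1 #> x"
        using Inter by simp
      then obtain k where k: "k \<in> K1" "\<one> = k \<otimes> x"
        by (auto simp: r_coset_def)
      then have "x = inv k"
        using xG subgroup.mem_carrier[OF K1sub] k by (metis inv_comm inv_equality)
      then show "x \<in> K1"
        using k subgroup.m_inv_closed[OF K1sub] by simp
    qed
    then show False
      using K1 by blast
  qed
qed

end

section \<open>Bounded obliquity and just infinite groups\<close>

text \<open>The common form of the two conditions on \<open>G\<close>: with the flag set, every open subgroup is
  just infinite; otherwise only \<open>G\<close> itself is required to be.\<close>

definition just_infinite_flag :: "bool \<Rightarrow> ('a, 'm) monoid_scheme \<Rightarrow> 'a topology \<Rightarrow> bool" where
  "just_infinite_flag s G T \<longleftrightarrow> (\<forall>H. open_subgroup H G T \<and> (s \<or> H = carrier G) \<longrightarrow>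
     just_infinite (G\<lparr>carrier := H\<rparr>) (subtopology T H))"

context profinite
begin

lemma just_infinite_flag_iff:
  "just_infinite_flag False G T \<longleftrightarrow> just_infinite G T"
  "just_infinite_flag True G T \<longleftrightarrow> hereditarily_just_infinite G T"
proof -
  have "G\<lparr>carrier := carrier G\<rparr> = G" "subtopology T (carrier G) = T"
    using topspace_eq subtopology_topspace[of T] by simp_all
  then show "just_infinite_flag False G T \<longleftrightarrow> just_infinite G T"
    by (simp add: just_infinite_flag_def open_subgroup_carrier)
  show "just_infinite_flag True G T \<longleftrightarrow> hereditarily_just_infinite G T"
    using profinite by (simp add: just_infinite_flag_def hereditarily_just_infinite_def)
qed

lemma just_infinite_flagD: "just_infinite_flag s G T \<Longrightarrow> just_infinite G T"
  unfolding just_infinite_flag_iff(1)[symmetric] just_infinite_flag_def by blast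

lemma open_subgroup_in_iff:
  assumes J: "open_subgroup J G T" and K: "K \<subseteq> J"
  shows "open_normal K (G\<lparr>carrier := J\<rparr>) (subtopology T J) \<longleftrightarrow>
      open_subgroup K G T \<and> J \<subseteq> normalizer G K"
proof -
  have sub: "subgroup J G" and op: "openin T J"
    using J by (auto simp: open_subgroup_def)
  have *: "openin (subtopology T J) K \<longleftrightarrow> openin T K"
    using K by (simp add: openin_open_subtopology[OF op])
  have "subgroup K (G\<lparr>carrier := J\<rparr>) \<Longrightarrow> subgroup K G"
    using incl_subgroup[OF sub] .
  then have "K \<lhd> G\<lparr>carrier := J\<rparr> \<longleftrightarrow> subgroup K G \<and> J \<subseteq> normalizer G K"
    using normal_in_subgroup_iff[OF sub _ K] normal_imp_subgroup[of K "G\<lparr>carrier := J\<rparr>"] by metis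
  then show ?thesis
    by (auto simp: open_normal_def open_subgroup_def *)
qed

lemma profinite_subgroup: "open_subgroup J G T \<Longrightarrow> profinite (G\<lparr>carrier := J\<rparr>) (subtopology T J)"
  using profinite_open_subgroup subgroup_imp_group
  by (simp add: profinite_def profinite_axioms_def open_subgroup_def)

lemma ex_open_normal_avoiding:
  assumes "x \<in> carrier G" "x \<noteq> \<one>"
  obtains K where "open_normal K G T" "x \<notin> K"
proof (rule closed_normal_separation[OF closed_normal_one assms(1)])
  show "x \<notin> {\<one>}"
    using assms(2) by simp
qed (use that in simp)

lemma openin_finite_Inter:
  assumes "finite \<K>" "\<And>K. K \<in> \<K> \<Longrightarrow> openin T K" "openin T U"
  shows "openin T (U \<inter> \<Inter>\<K>)"
  using assms by (induction \<K>) (auto simp: Int_left_commute openin_Int)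

text \<open>Otherwise an open normal subgroup of largest index is contained in all the others, hence
  trivial.\<close>

lemma infinite_imp_large_index:
  assumes inf: "infinite (carrier G)"
  obtains H where "open_normal H G T" "\<not> subgroup_index G H \<le> enat n"
proof (rule ccontr)
  assume no: "\<not> thesis"
  note thesisI = that
  have le: "subgroup_index G H \<le> enat n" if H: "open_normal H G T" for H
    by (rule ccontr) (use no thesisI[OF H] in blast)
  have fin: "finite (rcosets H)" if "open_normal H G T" for H
    by (rule finite_rcosets_open_subgroup[OF open_normal_imp_open_subgroup[OF that]])
  have idx: "subgroup_index G H = enat (card (rcosets H))" if "open_normal H G T" for H
    using fin[OF that] by (simp add: subgroup_index_def)
  have "\<forall>H. open_normal H G T \<longrightarrow> card (rcosets H) < Suc n"
    using le idx by (simp add: less_Suc_eq_le)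
  with open_normal_carrier have "\<exists>H. open_normal H G T \<and> (\<forall>K. open_normal K G T \<longrightarrow> card (rcosets K) \<le> card (rcosets H))"
    by (rule ex_has_greatest_nat[of "\<lambda>H. open_normal H G T"])
  then obtain H where H: "open_normal H G T"
    and max: "\<forall>K. open_normal K G T \<longrightarrow> card (rcosets K) \<le> card (rcosets H)"
    by (elim exE conjE)
  have sub: "subgroup K G" if "open_normal K G T" for K
    using that by (simp add: open_normal_def normal_imp_subgroup)
  have H_least: "H \<subseteq> K" if K: "open_normal K G T" for K
  proof -
    have HK: "open_normal (H \<inter> K) G T"
      by (rule open_normal_Int[OF H K])
    have "H \<inter> K = H"
      using max HK idx[OF HK] idx[OF H] by (intro subgroup_eq_of_index_le sub fin HK H) auto
    then show ?thesis
      by blast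
  qed
  have "H \<subseteq> {\<one>}"
  proof
    fix x assume x: "x \<in> H"
    have "x \<in> carrier G"
      by (rule subgroup.mem_carrier[OF sub[OF H] x])
    then show "x \<in> {\<one>}"
      using ex_open_normal_avoiding[of x] H_least x by (metis singletonI subsetD)
  qed
  then have "H = {\<one>}"
    using subgroup.one_closed[OF sub[OF H]] by blast
  then show False
    using finite_carrier_of_finite_rcosets_one fin[OF H] inf by simp
qed

text \<open>An open normal subgroup of index greater than \<open>n\<close> contains no subgroup of index at most
  \<open>n\<close>, so there are only finitely many of the latter.\<close>

lemma just_infinite_openin_I_above:
  assumes ji: "just_infinite G T"
  shows "openin T (I_above G T {\<one>} n)"
proof -
  let ?S = "{K. open_normal K G T \<and> {\<one>} \<subseteq> K \<and> subgroup_index G K \<le> enat n}"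
  have inf: "infinite (carrier G)"
    using ji by (simp add: just_infinite_iff)
  obtain H where H: "open_normal H G T" "\<not> subgroup_index G H \<le> enat n"
    by (rule infinite_imp_large_index[OF inf])
  have sub: "subgroup K G" "openin T K" if "open_normal K G T" for K
    using that by (simp_all add: open_normal_def normal_imp_subgroup)
  have "?S \<subseteq> {K. open_normal K G T \<and> \<not> K \<subseteq> H}"
  proof clarify
    fix K assume "open_normal K G T" "subgroup_index G K \<le> enat n" "K \<subseteq> H"
    then show False
      using subgroup_index_antimono[OF sub(1) sub(1)[OF H(1)], of K] H(2) order_trans by blast
  qed
  then have "finite ?S"
    using just_infinite_finite_not_subset[OF ji sub(2)[OF H(1)] subgroup.one_closed[OF sub(1)[OF H(1)]]]
    by (rule finite_subset)
  then show ?thesis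
    unfolding I_above_def
    by (rule openin_finite_Inter) (use sub(2) openin_topspace[of T] topspace_eq in auto)
qed

text \<open>A subgroup \<open>K\<close> that is normalised by \<open>H\<close> is normal in its normaliser, which is one of the
  finitely many subgroups above \<open>H\<close>. So by the finiteness result for just infinite groups
  only finitely many such \<open>K\<close> are not contained in \<open>H\<close>.\<close>

lemma just_infinite_flag_openin_Ob_above:
  assumes ji: "just_infinite_flag s G T" and H: "open_subgroup H G T"
  shows "openin T (Ob_above s G T {\<one>} H)"
proof -
  let ?S = "{K. open_subgroup K G T \<and> {\<one>} \<subseteq> K \<and> (if s then H else carrier G) \<subseteq> normalizer G K \<and> \<not> K \<subseteq> H}"
  let ?Js = "{J. (subgroup J G \<and> H \<subseteq> J) \<and> (s \<or> J = carrier G)}"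
  let ?Ns = "\<lambda>J. {K. open_normal K (G\<lparr>carrier := J\<rparr>) (subtopology T J) \<and> \<not> K \<subseteq> H}"
  have Hsub: "subgroup H G" "openin T H"
    using H by (auto simp: open_subgroup_def)
  have "?S \<subseteq> (\<Union>J\<in>?Js. ?Ns J)"
  proof
    fix K assume K: "K \<in> ?S"
    then have Kop: "open_subgroup K G T" and Ksub: "subgroup K G"
      by (auto simp: open_subgroup_def)
    let ?NK = "normalizer G K"
    have J0: "subgroup ?NK G" "openin T ?NK" "K \<subseteq> ?NK"
      using Ksub Kop by (auto intro: subgroup_normalizer openin_normalizer subsetD[OF subset_normalizer_self])
    have "H \<subseteq> ?NK" "s \<or> ?NK = carrier G"
      using K subgroup.subset[OF J0(1)] subgroup.subset[OF Hsub(1)] by (auto split: if_splits)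
    moreover have "open_normal K (G\<lparr>carrier := ?NK\<rparr>) (subtopology T ?NK)"
      using J0 Kop by (subst open_subgroup_in_iff) (simp_all add: open_subgroup_def)
    ultimately show "K \<in> (\<Union>J\<in>?Js. ?Ns J)"
      using K J0(1) by (intro UN_I[of ?NK]) simp_all
  qed
  moreover have "finite (\<Union>J\<in>?Js. ?Ns J)"
  proof (rule finite_UN_I)
    show "finite ?Js"
      by (rule finite_subset[OF _ finite_subgroups_above[OF Hsub(1) finite_rcosets_open_subgroup[OF H]]]) auto
    fix J assume J: "J \<in> ?Js"
    then have Jop: "open_subgroup J G T"
      using openin_supergroup[OF H] by (auto simp: open_subgroup_def)
    interpret J: profinite "G\<lparr>carrier := J\<rparr>" "subtopology T J"
      by (rule profinite_subgroup[OF Jop])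
    show "finite (?Ns J)"
    proof (rule J.just_infinite_finite_not_subset)
      show "just_infinite (G\<lparr>carrier := J\<rparr>) (subtopology T J)"
        using ji J Jop by (auto simp: just_infinite_flag_def)
      show "openin (subtopology T J) H"
        using J Jop Hsub by (auto simp: openin_open_subtopology open_subgroup_def)
      show "\<one>\<^bsub>G\<lparr>carrier := J\<rparr>\<^esub> \<in> H"
        using subgroup.one_closed[OF Hsub(1)] by simp
    qed
  qed
  ultimately have "finite ?S"
    by (rule finite_subset)
  then show ?thesis
    unfolding Ob_above_def by (rule openin_finite_Inter) (use Hsub in \<open>auto simp: open_subgroup_def\<close>)
qed

lemma just_infinite_flag_finite_index:
  assumes ji: "just_infinite_flag s G T"
  shows "finite (rcosets (OI_above s G T {\<one>} n))"
proof (rule finite_rcosets_open_subgroup)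
  have "open_subgroup (I_above G T {\<one>} n) G T"
    using just_infinite_openin_I_above[OF just_infinite_flagD[OF ji]] subgroup_I_above
    by (simp add: open_subgroup_def)
  then show "open_subgroup (OI_above s G T {\<one>} n) G T"
    using just_infinite_flag_openin_Ob_above[OF ji] subgroup_OI_above
    by (simp add: open_subgroup_def OI_above_def)
qed

lemma closedin_OI_above: "closedin T (OI_above s G T M n)"
proof -
  have "OI_above s G T M n = \<Inter>(insert (I_above G T M n) {K. open_subgroup K G T \<and> M \<subseteq> K \<and>
       (if s then I_above G T M n else carrier G) \<subseteq> normalizer G K \<and> \<not> K \<subseteq> I_above G T M n})"
    by (simp add: OI_above_def Ob_above_def)
  also have "closedin T \<dots>"
    by (intro closedin_Inter) (auto intro: closedin_open_subgroup closedin_I_above)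
  finally show ?thesis .
qed

text \<open>Conversely, a non-trivial closed normal subgroup \<open>N\<close> of an open subgroup \<open>H\<close> contains an
  obliquity subgroup: for large \<open>n\<close> the intersection of the open normal subgroups of index at
  most \<open>n\<close> lies in \<open>H\<close> and does not contain \<open>N\<close>, and \<open>N\<close> is an intersection of open subgroups
  that are normal in \<open>H\<close>.\<close>

lemma finite_index_imp_just_infinite_flag:
  assumes inf: "infinite (carrier G)"
    and fin: "\<And>n. n \<ge> 1 \<Longrightarrow> finite (rcosets (OI_above s G T {\<one>} n))"
  shows "just_infinite_flag s G T"
  unfolding just_infinite_flag_def
proof (intro allI impI)
  fix H assume "open_subgroup H G T \<and> (s \<or> H = carrier G)"
  then have H: "open_subgroup H G T" and s: "s \<or> H = carrier G"
    by auto
  have Hsub: "subgroup H G" "openin T H"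
    using H by (auto simp: open_subgroup_def)
  interpret H: profinite "G\<lparr>carrier := H\<rparr>" "subtopology T H"
    by (rule profinite_subgroup[OF H])
  have "infinite H"
  proof
    assume "finite H"
    then have "finite (\<Union>(rcosets H))"
      using finite_rcosets_open_subgroup[OF H] by (intro finite_Union) (auto simp: RCOSETS_def r_coset_def)
    then show False
      using inf rcosets_part_G[OF Hsub(1)] by simp
  qed
  moreover have "openin (subtopology T H) N"
    if N: "closed_normal N (G\<lparr>carrier := H\<rparr>) (subtopology T H)" and ne: "N \<noteq> {\<one>}" for N
  proof -
    have NH: "subgroup N (G\<lparr>carrier := H\<rparr>)"
      using N by (simp add: closed_normal_def normal_imp_subgroup)
    have NG: "subgroup N G"
      by (rule incl_subgroup[OF Hsub(1) NH])
    have "N \<subseteq> H"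
      using subgroup.subset[OF NH] by simp
    obtain x where x: "x \<in> N" "x \<noteq> \<one>"
      using ne subgroup.one_closed[OF NG] by blast
    obtain K0 where K0: "open_normal K0 G T" "x \<notin> K0"
      using ex_open_normal_avoiding[OF subgroup.mem_carrier[OF NG x(1)] x(2)] .
    obtain K1 where K1: "open_normal K1 G T" "K1 \<subseteq> H"
      using open_normal_base[OF Hsub(2) subgroup.one_closed[OF Hsub(1)]] .
    define K where "K = K0 \<inter> K1"
    have K: "open_normal K G T" "x \<notin> K" "K \<subseteq> H"
      using K0 K1 open_normal_Int by (auto simp: K_def)
    define n where "n = max 1 (card (rcosets K))"
    have "subgroup_index G K \<le> enat n"
      using finite_rcosets_open_subgroup[OF open_normal_imp_open_subgroup[OF K(1)]]
      by (simp add: subgroup_index_def n_def)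
    moreover have "\<one> \<in> K"
      using K(1) by (simp add: open_normal_def normal_imp_subgroup subgroup.one_closed)
    ultimately have IK: "I_above G T {\<one>} n \<subseteq> K"
      using K(1) unfolding I_above_def by (intro le_infI2 Inter_lower) simp
    let ?O = "OI_above s G T {\<one>} n"
    have OH: "?O \<subseteq> H"
      using IK K(3) by (auto simp: OI_above_def Ob_above_def)
    have OL: "?O \<subseteq> L" if L: "open_normal L (G\<lparr>carrier := H\<rparr>) (subtopology T H)" "N \<subseteq> L" for L
    proof -
      have "L \<subseteq> H"
        using L subgroup.subset[of L "G\<lparr>carrier := H\<rparr>"] by (simp add: open_normal_def normal_imp_subgroup)
      then have L': "open_subgroup L G T" "H \<subseteq> normalizer G L"
        using L open_subgroup_in_iff[OF H] by blast+
      then have "{\<one>} \<subseteq> L"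
        by (simp add: open_subgroup_def subgroup.one_closed)
      moreover have "(if s then I_above G T {\<one>} n else carrier G) \<subseteq> normalizer G L"
        using L'(2) s IK K(3) by auto
      moreover have "\<not> L \<subseteq> I_above G T {\<one>} n"
        using x(1) L(2) K(2) IK by blast
      ultimately show ?thesis
        using L'(1) unfolding OI_above_def Ob_above_def by (intro le_infI2 Inter_lower) simp
    qed
    have "?O \<subseteq> N"
    proof (rule ccontr)
      assume "\<not> ?O \<subseteq> N"
      then obtain y where y: "y \<in> ?O" "y \<notin> N"
        by blast
      then have "y \<in> carrier (G\<lparr>carrier := H\<rparr>)"
        using OH by auto
      from H.closed_normal_separation[OF N this y(2)] show False
        using OL y(1) by (metis subsetD)
    qed
    moreover have "open_subgroup ?O G T"
      using openin_closed_subgroup_finite_index[OF subgroup_OI_above closedin_OI_above fin[of n]] subgroup_OI_above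
      by (simp add: open_subgroup_def n_def)
    ultimately have "openin T N"
      using openin_supergroup NG by simp
    then show ?thesis
      using \<open>N \<subseteq> H\<close> by (simp add: openin_open_subtopology[OF Hsub(2)])
  qed
  ultimately show "just_infinite (G\<lparr>carrier := H\<rparr>) (subtopology T H)"
    unfolding H.just_infinite_iff by simp
qed

lemma ex_bounded_obliquity_iff:
  "(\<exists>\<eta>\<in>pos_funs. bounded_obliquity s \<eta> G T) \<longleftrightarrow> (\<forall>n\<ge>1. finite (rcosets (OI_above s G T {\<one>} n)))"
proof
  assume "\<exists>\<eta>\<in>pos_funs. bounded_obliquity s \<eta> G T"
  then obtain \<eta> where "bounded_obliquity s \<eta> G T"
    by blast
  then show "\<forall>n\<ge>1. finite (rcosets (OI_above s G T {\<one>} n))"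
    by (auto simp: bounded_obliquity_def subgroup_index_def split: if_splits)
next
  assume fin: "\<forall>n\<ge>1. finite (rcosets (OI_above s G T {\<one>} n))"
  define \<eta> where "\<eta> n = max 1 (card (rcosets (OI_above s G T {\<one>} n)))" for n
  have "\<eta> \<in> pos_funs"
    by (auto simp: \<eta>_def pos_funs_def)
  moreover have "bounded_obliquity s \<eta> G T"
    using fin profinite by (simp add: bounded_obliquity_def subgroup_index_def \<eta>_def)
  ultimately show "\<exists>\<eta>\<in>pos_funs. bounded_obliquity s \<eta> G T"
    by blast
qed

lemma finite_or_just_infinite_flag_iff:
  "finite (carrier G) \<or> just_infinite_flag s G T \<longleftrightarrow> (\<exists>\<eta>\<in>pos_funs. bounded_obliquity s \<eta> G T)"
  unfolding ex_bounded_obliquity_iff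
  using finite_rcosets_of_finite just_infinite_flag_finite_index finite_index_imp_just_infinite_flag
  by metis

end

theorem theoremB:
  fixes G :: "('a, 'm) monoid_scheme" and T :: "'a topology"
  assumes "profinite_group G T"
  shows
    "(((finite (carrier G) \<or> just_infinite G T)
         \<longleftrightarrow> (\<exists>\<eta>\<in>pos_funs. O_class \<eta> G T)) \<and>
      ((\<exists>\<eta>\<in>pos_funs. O_class \<eta> G T)
         \<longleftrightarrow> (\<exists>\<eta>\<in>pos_funs. every_image (O_class \<eta>) G T)) \<and>
      ((\<exists>\<eta>\<in>pos_funs. every_image (O_class \<eta>) G T)
         \<longleftrightarrow> (\<exists>\<eta>\<in>pos_funs. \<exists>(I :: 'i set) r N. inverse_limit_of_images (O_class \<eta>) G T I r N)) \<and>
      (\<forall>\<eta>\<in>pos_funs.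
         (O_class \<eta> G T \<longleftrightarrow> every_image (O_class \<eta>) G T) \<and>
         (every_image (O_class \<eta>) G T
            \<longleftrightarrow> (\<exists>(I :: 'i set) r N. inverse_limit_of_images (O_class \<eta>) G T I r N))))
     \<and>
     (((finite (carrier G) \<or> hereditarily_just_infinite G T)
         \<longleftrightarrow> (\<exists>\<eta>\<in>pos_funs. O_star_class \<eta> G T)) \<and>
      ((\<exists>\<eta>\<in>pos_funs. O_star_class \<eta> G T)
         \<longleftrightarrow> (\<exists>\<eta>\<in>pos_funs. every_image (O_star_class \<eta>) G T)) \<and>
      ((\<exists>\<eta>\<in>pos_funs. every_image (O_star_class \<eta>) G T)
         \<longleftrightarrow> (\<exists>\<eta>\<in>pos_funs. \<exists>(I :: 'i set) r N. inverse_limit_of_images (O_star_class \<eta>) G T I r N)) \<and>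
      (\<forall>\<eta>\<in>pos_funs.
         (O_star_class \<eta> G T \<longleftrightarrow> every_image (O_star_class \<eta>) G T) \<and>
         (every_image (O_star_class \<eta>) G T
            \<longleftrightarrow> (\<exists>(I :: 'i set) r N. inverse_limit_of_images (O_star_class \<eta>) G T I r N))))"
proof -
  interpret profinite G T
    using assms by (simp add: profinite_def profinite_axioms_def profinite_group_def topological_group_def)
  have fin: "finite (carrier G) \<or> just_infinite G T \<longleftrightarrow> (\<exists>\<eta>\<in>pos_funs. O_class \<eta> G T)"
    "finite (carrier G) \<or> hereditarily_just_infinite G T \<longleftrightarrow> (\<exists>\<eta>\<in>pos_funs. O_star_class \<eta> G T)"
    using finite_or_just_infinite_flag_iff
    by (simp_all only: just_infinite_flag_iff[symmetric] bounded_obliquity_eq[symmetric])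
  have img: "every_image (O_class \<eta>) G T \<longleftrightarrow> O_class \<eta> G T"
    "every_image (O_star_class \<eta>) G T \<longleftrightarrow> O_star_class \<eta> G T" for \<eta>
    using every_image_bounded_obliquity_iff by (simp_all only: bounded_obliquity_eq[symmetric])
  have lim: "(\<exists>(I :: 'i set) r N. inverse_limit_of_images (O_class \<eta>) G T I r N) \<longleftrightarrow> O_class \<eta> G T"
    "(\<exists>(I :: 'i set) r N. inverse_limit_of_images (O_star_class \<eta>) G T I r N) \<longleftrightarrow> O_star_class \<eta> G T" for \<eta>
    by (simp_all only: bounded_obliquity_eq[symmetric] bounded_obliquity_iff_inverse_limit[where 'i = 'i, symmetric])
  show ?thesis
    unfolding fin img lim by simp
qed

end
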